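(* Let $a_1,\ldots,a_n\in\mathbb{D}$ and let $B(z)=\prod_{k=1}^n \frac{z-a_k}{1-\overline{a_k}z}$ be the monic Blaschke product with zeros $a_1,\ldots,a_n$. Assume $B'(0)\neq 0$, and list the critical points of $B$ (the $2n-2$ zeros of $B'$, counted with multiplicity) as $\zeta_1,\ldots,\zeta_{n-1}\in\mathbb{D}\setminus\{0\}$ and $\zeta_1^*,\ldots,\zeta_{n-1}^*\in\mathbb{D}^*$. Let $W$, $\widetilde W$, $A$, $\alpha$, $T(\delta)=(\tau_1(\delta),\ldots,\tau_n(\delta))$, $Q$, $S$ and $S_{\mathbb{R}}$ be as defined in the context (for this $B$ and these $\zeta_k$). Then: (i) On $A\cap Q$ the tangential gradient of $W$ vanishes exactly on the set $S$; more precisely, for $(\tau_1,\ldots,\tau_n)\in A\cap Q$ one has $\nabla\widetilde W(\tau_1,\ldots,\tau_n)=0$ if and only if $(\tau_1,\ldots,\tau_n)=T(\delta)$ for some $\delta\in[\alpha,\alpha+2n\pi)$. (ii) All points of $S_{\mathbb{R}}$ are global minimum points of $\widetilde W$.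
   Context: Notation: $\mathbb{D}=\{z\in\mathbb{C}:|z|<1\}$, $\mathbb{D}^*=\{z\in\mathbb{C}:|z|>1\}$, $\zeta^*=1/\overline{\zeta}$ for $\zeta\ne0$. It is well known (Walsh) that if $B$ is a Blaschke product of degree $n$ with $B'(0)\ne 0$, then $B'$ has $2n-2$ zeros counted with multiplicity, $n-1$ of them in $\mathbb{D}\setminus\{0\}$, and if $\zeta$ is a zero then $\zeta^*$ is a zero of the same multiplicity. Energy: for $|w_1|=\dots=|w_n|=1$, $$W(w_1,\ldots,w_n)=\sum_{k=1}^{n-1}\sum_{j=1}^n\log|(w_j-\zeta_k)(w_j-\zeta_k^* )|-2\sum_{1\le j<k\le n}\log|w_j-w_k|,$$ with value $+\infty$ if $w_j=w_k$ for some $j\neq k$. For $(\tau_1,\ldots,\tau_n)\in\mathbb{R}^n$ put $\widetilde W(\tau_1,\ldots,\tau_n)=W(e^{i\tau_1},\ldots,e^{i\tau_n})$; the tangential gradient of $W$ is $\nabla\widetilde W$. Solution curve: $A=\{(\tau_1,\ldots,\tau_n)\in\mathbb{R}^n:\tau_1<\tau_2<\ldots<\tau_n<\tau_1+2\pi\}$. Let $\alpha=\arg B(1)\in[-\pi,\pi)$. There are uniquely determined continuously differentiable, strictly increasing functions $\tau_1,\ldots,\tau_n:\mathbb{R}\to\mathbb{R}$ such that $B(e^{i\tau_j(\delta)})=e^{i\delta}$ for all $j$ and all $\delta\in\mathbb{R}$, $\tau_1(\delta)<\ldots<\tau_n(\delta)<\tau_1(\delta)+2\pi$ for all $\delta$,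 and $\tau_1(\alpha)=0$. Put $T(\delta)=(\tau_1(\delta),\ldots,\tau_n(\delta))$, $S_{\mathbb{R}}=\{T(\delta):\delta\in\mathbb{R}\}$, $S=\{T(\delta):\delta\in[\alpha,\alpha+2n\pi)\}$, and $$Q=[0,2\pi)\times[\tau_2(\alpha),\tau_2(\alpha)+2\pi)\times\cdots\times[\tau_n(\alpha),\tau_n(\alpha)+2\pi).$$ *)

theory Defs
  imports "HOL-Complex_Analysis.Complex_Analysis"
begin

(* Points of R^n and C^n are vectors indexed by a finite linearly ordered type 'n, n = CARD('n).
   The indices 1 and n are Min UNIV and Max UNIV. *)

definition blaschke :: "complex ^ 'n \<Rightarrow> complex \<Rightarrow> complex" where
  "blaschke a z = (\<Prod>j\<in>UNIV. (z - a $ j) / (1 - cnj (a $ j) * z))"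

definition reflect :: "complex \<Rightarrow> complex" where
  "reflect \<zeta> = 1 / cnj \<zeta>"

(* zeta 1, ..., zeta (n-1) and their reflections list the zeros of B' with multiplicity.
   If zeta k is a multiple zero of B, then its reflection is a multiple pole of B, that is,
   a critical point of B only as a map of the Riemann sphere. Multiplicities in B' are
   therefore compared only where B is defined; this includes the whole unit disc, so the
   list is determined up to order. *)
definition lists_critical_points :: "complex ^ 'n \<Rightarrow> (nat \<Rightarrow> complex) \<Rightarrow> bool" where
  "lists_critical_points a \<zeta> \<longleftrightarrow>
     (\<forall>k\<in>{1..<CARD('n)}. \<zeta> k \<in> ball 0 1 - {0}) \<and>
     (\<forall>z. (\<forall>j. 1 - cnj (a $ j) * z \<noteq> 0) \<longrightarrow>
        zorder (deriv (blaschke a)) z =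
          int (card {k\<in>{1..<CARD('n)}. \<zeta> k = z} + card {k\<in>{1..<CARD('n)}. reflect (\<zeta> k) = z}))"

definition energy :: "(nat \<Rightarrow> complex) \<Rightarrow> complex ^ 'n::{finite,linorder} \<Rightarrow> ereal" where
  "energy \<zeta> w =
     (if \<exists>j k. j \<noteq> k \<and> w $ j = w $ k then \<infinity>
      else ereal ((\<Sum>k\<in>{1..<CARD('n)}. \<Sum>j\<in>UNIV.
                      ln (cmod ((w $ j - \<zeta> k) * (w $ j - reflect (\<zeta> k)))))
                  - 2 * (\<Sum>(j, k)\<in>{(j, k). j < k}. ln (cmod (w $ j - w $ k)))))"

definition angular_energy :: "(nat \<Rightarrow> complex) \<Rightarrow> real ^ 'n::{finite,linorder} \<Rightarrow> ereal" where
  "angular_energy \<zeta> \<tau> = energy \<zeta> (\<chi> j. cis (\<tau> $ j))"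

(* The energy is finite near any point with pairwise distinct cis (tau $ j), so there
   real_of_ereal only changes the type. *)
definition gradient_vanishes :: "(nat \<Rightarrow> complex) \<Rightarrow> real ^ 'n::{finite,linorder} \<Rightarrow> bool" where
  "gradient_vanishes \<zeta> \<tau> \<longleftrightarrow> (GDERIV (\<lambda>\<sigma>. real_of_ereal (angular_energy \<zeta> \<sigma>)) \<tau> :> 0)"

definition ordered_angles :: "(real ^ 'n::{finite,linorder}) set" where
  "ordered_angles = {\<tau>. (\<forall>i j. i < j \<longrightarrow> \<tau> $ i < \<tau> $ j) \<and> \<tau> $ Max UNIV < \<tau> $ Min UNIV + 2 * pi}"

definition half_open_cube :: "real ^ 'n \<Rightarrow> (real ^ 'n) set" where
  "half_open_cube p = {\<tau>. \<forall>j. \<tau> $ j \<in> {p $ j..<p $ j + 2 * pi}}"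

definition solution_curve ::
  "complex ^ 'n::{finite,linorder} \<Rightarrow> real \<Rightarrow> (real \<Rightarrow> real ^ 'n::{finite,linorder}) \<Rightarrow> bool" where
  "solution_curve a \<alpha> T \<longleftrightarrow>
     (\<forall>j. (\<lambda>\<delta>. T \<delta> $ j) C1_differentiable_on UNIV \<and> strict_mono (\<lambda>\<delta>. T \<delta> $ j)) \<and>
     (\<forall>j \<delta>. blaschke a (cis (T \<delta> $ j)) = cis \<delta>) \<and>
     (\<forall>\<delta>. T \<delta> \<in> ordered_angles) \<and>
     T \<alpha> $ Min UNIV = 0"

end

theory Submission
  imports Defs
begin

text \<open>
  Write \<open>B = P / S\<close> with \<open>P = \<Prod>\<^sub>j (z - a\<^sub>j)\<close> and \<open>S = \<Prod>\<^sub>j (1 - cnj a\<^sub>j z)\<close>. The zeros of the Wronskian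
  \<open>R = P' S - P S'\<close> are the \<open>\<zeta>\<^sub>k\<close> and their mirror points, and \<open>R(x) = x\<^sup>n\<^sup>-\<^sup>1 |R(x)|\<close> on the unit circle.
  With \<open>q\<^sub>j = \<Prod>\<^sub>k\<^sub>\<noteq>\<^sub>j (z - w\<^sub>k)\<close> the energy of \<open>w\<close> is therefore, up to an additive constant,
  \<open>\<Sum>\<^sub>j log |R(w\<^sub>j)| - \<Sum>\<^sub>j log |q\<^sub>j(w\<^sub>j)|\<close> (\<open>energy_eq_log_ratio\<close>), where the second sum is the logarithm of
  the squared modulus of the Vandermonde determinant of \<open>w\<close>.

  For distinct \<open>w\<^sub>k\<close>, the notion that links stationary points of the energy, fibres of \<open>B\<close> and minimum
  points is that all residues of \<open>R / \<Prod>\<^sub>k (z - w\<^sub>k)\<^sup>2\<close> vanish. It holds at every point with vanishing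
  gradient, because on the circle \<open>R / q\<^sub>j\<^sup>2\<close> has constant phase and its modulus is, as a function of
  \<open>w\<^sub>j\<close>, a constant multiple of the exponential of the energy (\<open>gradient_vanishes_residue_free\<close>). It
  also holds on every fibre \<open>B = \<lambda>\<close> with \<open>|\<lambda>| = 1\<close>, because there
  \<open>\<Prod>\<^sub>k (z - w\<^sub>k)\<close> is a multiple of \<open>P - \<lambda> S\<close>, whose Wronskian with \<open>S\<close> is again \<open>R\<close>
  (\<open>residue_free_fibre\<close>).

  When the residues vanish, the partial fraction expansion of \<open>R / \<Prod>\<^sub>k (z - w\<^sub>k)\<^sup>2\<close> consists of double
  poles only and turns into \<open>|R(x)| = \<Sum>\<^sub>j m\<^sub>j |q\<^sub>j(x)|\<^sup>2\<close> on the circle, with positive \<open>m\<^sub>j\<close>. So \<open>|R(x\<^sub>i)|\<close> is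
  the squared norm of row \<open>i\<close> of the matrix \<open>sqrt m\<^sub>j q\<^sub>j(x\<^sub>i)\<close>, whose determinant is a constant multiple
  of the Vandermonde determinant of \<open>x\<close>. Hadamard's inequality then bounds the energy of \<open>x\<close> from below,
  with equality at \<open>x = w\<close>, where the matrix is diagonal. Hence residue-free configurations are global
  minimum points (\<open>residue_free_extremal\<close>); in particular the points of the curve are, and the gradient
  vanishes there.

  Conversely, let the gradient vanish at \<open>\<tau>\<close>, and choose the fibre \<open>w\<close> that contains the first point of
  \<open>x = e\<^sup>i\<^sup>\<tau>\<close>. Both \<open>x\<close> and \<open>w\<close> are global minimum points, so equality holds in Hadamard's inequality and
  the rows of the matrix are pairwise orthogonal. The first row has a single nonzero entry, since the first
  point of \<open>x\<close> is one of the \<open>w\<^sub>j\<close>; thus the other rows vanish in that column, which puts all points of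
  \<open>x\<close> into the fibre \<open>w\<close>. What remains is bookkeeping with angles: the curve gains exactly \<open>2 \<pi>\<close> in
  every coordinate when \<open>\<delta>\<close> grows by \<open>2 n \<pi>\<close> (\<open>curve_period\<close>), and an increasing tuple of angles is
  determined by its first entry and its points on the circle (\<open>ordered_angles_eqI\<close>).
\<close>

section \<open>Hadamard's determinant inequality\<close>

definition hermitian_inner :: "complex ^ 'n \<Rightarrow> complex ^ 'n \<Rightarrow> complex" where
  "hermitian_inner x y = (\<Sum>j\<in>UNIV. x $ j * cnj (y $ j))"

lemma hermitian_inner_add_left: "hermitian_inner (x + y) z = hermitian_inner x z + hermitian_inner y z"
  by (simp add: hermitian_inner_def algebra_simps sum.distrib)

lemma hermitian_inner_scale_left: "hermitian_inner (c *s x) y = c * hermitian_inner x y"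
  by (simp add: hermitian_inner_def sum_distrib_left mult.assoc)

lemma hermitian_inner_commute: "hermitian_inner x y = cnj (hermitian_inner y x)"
  by (simp add: hermitian_inner_def mult.commute)

lemma inner_eq_Re_hermitian_inner: "x \<bullet> y = Re (hermitian_inner x y)"
  by (simp add: hermitian_inner_def inner_vec_def inner_complex_def)

lemma hermitian_inner_self: "hermitian_inner x x = of_real ((norm x)\<^sup>2)"
proof -
  have "hermitian_inner x x = (\<Sum>j\<in>UNIV. of_real ((cmod (x $ j))\<^sup>2))"
    unfolding hermitian_inner_def
    by (intro sum.cong refl) (simp add: complex_norm_square[symmetric])
  also have "\<dots> = of_real ((norm x)\<^sup>2)"
    by (simp add: norm_vec_def L2_set_def sum_nonneg)
  finally show ?thesis .
qed

lemma hermitian_inner_span_zero: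
  assumes "y \<in> vec.span S" and "\<And>s. s \<in> S \<Longrightarrow> hermitian_inner s z = 0"
  shows "hermitian_inner y z = 0"
  using assms(1)
proof (induction rule: vec.span_induct_alt)
  case base
  then show ?case by (simp add: hermitian_inner_def)
next
  case (step c x y)
  then show ?case
    using assms(2) by (simp add: hermitian_inner_add_left hermitian_inner_scale_left)
qed

text \<open>
  A complex subspace is closed under multiplication by \<open>\<i>\<close>, so real orthogonality to it is the same
  as Hermitian orthogonality, and the orthogonal decomposition of the underlying Euclidean space
  serves in the Hermitian setting too.
\<close>

lemma hermitian_decomposition:
  fixes x :: "complex ^ 'n"
  obtains y z where "y \<in> vec.span S" "x = y + z" "\<forall>s\<in>S. hermitian_inner s z = 0"
proof -
  let ?V = "vec.span S"
  have scaleR: "r *\<^sub>R v = complex_of_real r *s v" for r and v :: "complex ^ 'n"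
    by (simp add: vec_eq_iff) (simp add: scaleR_conv_of_real)
  have "subspace ?V"
    by (rule subspaceI) (auto simp: scaleR vec.span_zero vec.span_add vec.span_scale)
  then have span_V: "span ?V = ?V" by (simp add: span_eq_iff)
  obtain y z where y: "y \<in> ?V" and z: "\<And>w. w \<in> ?V \<Longrightarrow> orthogonal z w" and "x = y + z"
    using orthogonal_subspace_decomp_exists[of ?V x] unfolding span_V by metis
  moreover have "hermitian_inner s z = 0" if "s \<in> S" for s
  proof (rule complex_eqI)
    have s: "s \<in> ?V" "\<i> *s s \<in> ?V" using that by (auto intro: vec.span_base vec.span_scale)
    have z': "Re (hermitian_inner w z) = 0" if "w \<in> ?V" for w
      using z[OF that] by (simp add: orthogonal_def inner_commute inner_eq_Re_hermitian_inner[symmetric])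
    show "Re (hermitian_inner s z) = Re 0" using z'[OF s(1)] by simp
    show "Im (hermitian_inner s z) = Im 0"
      using z'[OF s(2)] by (simp add: hermitian_inner_scale_left)
  qed
  ultimately show ?thesis using that by blast
qed

lemma norm_Pythagoras_hermitian:
  assumes "hermitian_inner y z = 0"
  shows "(norm (y + z))\<^sup>2 = (norm y)\<^sup>2 + (norm z)\<^sup>2"
proof -
  have "orthogonal y z" using assms by (simp add: orthogonal_def inner_eq_Re_hermitian_inner)
  then show ?thesis by (rule norm_add_Pythagorean)
qed

definition orthogonal_row :: "complex ^ 'n ^ 'n \<Rightarrow> 'n \<Rightarrow> bool" where
  "orthogonal_row A i \<longleftrightarrow> (\<forall>k. k \<noteq> i \<longrightarrow> hermitian_inner (A $ k) (A $ i) = 0)"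

text \<open>
  One Gram--Schmidt step: subtracting from a row its projection onto the span of the others keeps
  the determinant, does not lengthen the row, and leaves untouched the orthogonality of every row
  that was already orthogonal to all others.
\<close>

lemma orthogonalize_row:
  fixes A :: "complex ^ 'n ^ 'n"
  obtains v where
    "det (\<chi> k. if k = i then v else A $ k) = det A"
    "norm v \<le> norm (A $ i)" "norm v = norm (A $ i) \<longrightarrow> orthogonal_row A i"
    "orthogonal_row (\<chi> k. if k = i then v else A $ k) i"
    "\<forall>k. orthogonal_row A k \<longrightarrow> orthogonal_row (\<chi> k. if k = i then v else A $ k) k"
proof -
  let ?S = "{row j A | j. j \<noteq> i}"
  obtain y v where y: "y \<in> vec.span ?S" and Ai: "A $ i = y + v"
    and v: "\<forall>s\<in>?S. hermitian_inner s v = 0"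
    by (rule hermitian_decomposition[of ?S "A $ i"])
  have row: "row k A = A $ k" for k by (simp add: row_def)
  have v': "hermitian_inner (A $ k) v = 0" if "k \<noteq> i" for k
    by (rule bspec[OF v]) (use that in \<open>auto simp: row intro!: exI[of _ k]\<close>)
  have "- y \<in> vec.span ?S" using y by (simp add: vec.span_neg)
  moreover have "(\<chi> k. if k = i then row i A + - y else row k A) = (\<chi> k. if k = i then v else A $ k)"
    unfolding row Ai by (simp add: vec_eq_iff)
  ultimately have "det (\<chi> k. if k = i then v else A $ k) = det A"
    using det_row_span[of "- y" A i] by (simp only:)
  moreover have yv: "hermitian_inner y v = 0" by (rule hermitian_inner_span_zero[OF y]) (use v in blast)
  have pyth: "(norm (A $ i))\<^sup>2 = (norm y)\<^sup>2 + (norm v)\<^sup>2"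
    unfolding Ai by (rule norm_Pythagoras_hermitian[OF yv])
  then have "(norm v)\<^sup>2 \<le> (norm (A $ i))\<^sup>2" by simp
  then have "norm v \<le> norm (A $ i)" by (rule power2_le_imp_le) simp
  moreover have "norm v = norm (A $ i) \<longrightarrow> orthogonal_row A i"
  proof
    assume "norm v = norm (A $ i)"
    have "y = 0" using pyth \<open>norm v = norm (A $ i)\<close> by simp
    then show "orthogonal_row A i" using v' Ai by (simp add: orthogonal_row_def)
  qed
  moreover have "orthogonal_row (\<chi> k. if k = i then v else A $ k) i"
    using v' by (simp add: orthogonal_row_def)
  moreover have "orthogonal_row (\<chi> k. if k = i then v else A $ k) k" if k: "orthogonal_row A k" for k
  proof (cases "k = i")
    case True
    then show ?thesis using v' by (simp add: orthogonal_row_def)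
  next
    case False
    have "hermitian_inner v (A $ k) = 0"
      using v'[OF False] hermitian_inner_commute[of v "A $ k"] by simp
    then show ?thesis using k False by (simp add: orthogonal_row_def)
  qed
  ultimately show ?thesis using that by blast
qed

lemma det_cnj: "det (\<chi> i j. cnj (A $ i $ j)) = cnj (det (A :: complex ^ 'n ^ 'n))"
  by (simp add: det_def)

lemma norm_det_orthogonal_rows:
  fixes A :: "complex ^ 'n ^ 'n"
  assumes "\<And>i. orthogonal_row A i"
  shows "cmod (det A) = (\<Prod>i\<in>UNIV. norm (A $ i))"
proof -
  let ?H = "transpose (\<chi> i j. cnj (A $ i $ j))"
  have entry: "(A ** ?H) $ i $ k = hermitian_inner (A $ i) (A $ k)" for i k
    by (simp add: matrix_matrix_mult_def transpose_def hermitian_inner_def)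
  have "of_real ((cmod (det A))\<^sup>2) = det A * cnj (det A)"
    by (rule complex_norm_square)
  also have "\<dots> = det (A ** ?H)"
    by (simp add: det_mul det_transpose det_cnj)
  also have "\<dots> = (\<Prod>i\<in>UNIV. (A ** ?H) $ i $ i)"
    by (rule det_diagonal) (use assms in \<open>simp add: entry orthogonal_row_def\<close>)
  also have "\<dots> = of_real ((\<Prod>i\<in>UNIV. norm (A $ i))\<^sup>2)"
    by (simp only: entry hermitian_inner_self prod_power_distrib of_real_prod)
  finally have "(cmod (det A))\<^sup>2 = (\<Prod>i\<in>UNIV. norm (A $ i))\<^sup>2"
    using of_real_eq_iff by blast
  then show ?thesis by (simp add: power2_eq_iff_nonneg prod_nonneg)
qed

lemma prod_norm_rows_update:
  "(\<Prod>k\<in>UNIV. norm ((\<chi> k. if k = i then v else A $ k) $ k)) =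
     norm v * (\<Prod>k\<in>UNIV - {i}. norm (A $ k))"
  by (subst prod.remove[of _ i]) auto

text \<open>
  Orthogonalizing the rows one after the other never changes the determinant and never enlarges the
  product of the norms; at the end both agree.
\<close>

theorem Hadamard_inequality:
  fixes A :: "complex ^ 'n ^ 'n"
  shows "cmod (det A) \<le> (\<Prod>i\<in>UNIV. norm (A $ i))"
proof -
  have "cmod (det A) \<le> (\<Prod>i\<in>UNIV. norm (A $ i))"
    if "finite N" "\<And>i. i \<notin> N \<Longrightarrow> orthogonal_row A i" for N :: "'n set" and A :: "complex ^ 'n ^ 'n"
    using that
    \<comment> \<open>The set \<open>N\<close> contains the rows that remain to be orthogonalized.\<close>
  proof (induction N arbitrary: A rule: finite_induct)
    case empty
    then show ?case using norm_det_orthogonal_rows[of A] by simp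
  next
    case (insert i N)
    obtain v where v: "det (\<chi> k. if k = i then v else A $ k) = det A" "norm v \<le> norm (A $ i)"
      "norm v = norm (A $ i) \<longrightarrow> orthogonal_row A i"
      "orthogonal_row (\<chi> k. if k = i then v else A $ k) i"
      "\<forall>k. orthogonal_row A k \<longrightarrow> orthogonal_row (\<chi> k. if k = i then v else A $ k) k"
      by (rule orthogonalize_row[of i A])
    have "cmod (det (\<chi> k. if k = i then v else A $ k))
        \<le> (\<Prod>k\<in>UNIV. norm ((\<chi> k. if k = i then v else A $ k) $ k))"
    proof (rule insert.IH)
      fix k assume "k \<notin> N"
      then show "orthogonal_row (\<chi> k. if k = i then v else A $ k) k"
        using v(4,5) insert.prems by (cases "k = i") auto
    qed
    also have "\<dots> \<le> norm (A $ i) * (\<Prod>k\<in>UNIV - {i}. norm (A $ k))"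
      unfolding prod_norm_rows_update
      by (intro mult_right_mono v prod_nonneg) simp
    also have "\<dots> = (\<Prod>k\<in>UNIV. norm (A $ k))"
      by (subst (2) prod.remove[of _ i]) auto
    finally show ?case by (simp only: v(1))
  qed
  from this[of UNIV A] show ?thesis by simp
qed

text \<open>
  If row \<open>i\<close> were not orthogonal to the others, orthogonalizing it would shrink its norm strictly and
  violate Hadamard's inequality for the new matrix. The determinant must be nonzero, since a zero row
  makes both sides vanish without any orthogonality of the others.
\<close>

theorem Hadamard_equality:
  fixes A :: "complex ^ 'n ^ 'n"
  assumes eq: "cmod (det A) = (\<Prod>i\<in>UNIV. norm (A $ i))" and "det A \<noteq> 0"
  shows "orthogonal_row A i"
proof -
  obtain v where v: "det (\<chi> k. if k = i then v else A $ k) = det A" "norm v \<le> norm (A $ i)"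
    "norm v = norm (A $ i) \<longrightarrow> orthogonal_row A i"
    "orthogonal_row (\<chi> k. if k = i then v else A $ k) i"
    "\<forall>k. orthogonal_row A k \<longrightarrow> orthogonal_row (\<chi> k. if k = i then v else A $ k) k"
    by (rule orthogonalize_row[of i A])
  let ?p = "\<Prod>k\<in>UNIV - {i}. norm (A $ k)"
  have split: "(\<Prod>k\<in>UNIV. norm (A $ k)) = norm (A $ i) * ?p"
    by (subst prod.remove[of _ i]) auto
  have "norm (A $ i) * ?p \<le> norm v * ?p"
    using Hadamard_inequality[of "\<chi> k. if k = i then v else A $ k"]
    unfolding prod_norm_rows_update v(1) eq split .
  moreover have "norm (A $ i) * ?p \<noteq> 0"
    using assms split by force
  then have "?p > 0" by (simp add: prod_nonneg less_le)
  ultimately have "norm (A $ i) \<le> norm v" by simp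
  with v show ?thesis by simp
qed

section \<open>Interpolation determinants\<close>

definition punctured_poly :: "complex ^ 'n \<Rightarrow> 'n \<Rightarrow> complex poly" where
  "punctured_poly w j = (\<Prod>k\<in>UNIV - {j}. [:- (w $ k), 1:])"

text \<open>The squared modulus of the Vandermonde determinant of \<open>x\<close>.\<close>

definition separation :: "complex ^ 'n \<Rightarrow> real" where
  "separation x = (\<Prod>i\<in>UNIV. cmod (poly (punctured_poly x i) (x $ i)))"

lemma poly_punctured_poly: "poly (punctured_poly w j) z = (\<Prod>k\<in>UNIV - {j}. z - w $ k)"
  by (simp add: punctured_poly_def poly_prod)

lemma degree_punctured_poly: "degree (punctured_poly (w :: complex ^ 'n) j) < CARD('n)"
proof -
  have "degree (punctured_poly w j) \<le> (\<Sum>k\<in>UNIV - {j}. degree [:- (w $ k), 1:])"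
    unfolding punctured_poly_def using degree_prod_sum_le[of "UNIV - {j}" "\<lambda>k. [:- (w $ k), 1:]"] by (simp add: o_def)
  then have "degree (punctured_poly w j) \<le> CARD('n) - 1"
    by (simp add: card_Diff_singleton)
  moreover have "CARD('n) > 0" by simp
  ultimately show ?thesis by linarith
qed

lemma punctured_poly_other_node: "i \<noteq> j \<Longrightarrow> poly (punctured_poly w j) (w $ i) = 0"
  by (auto simp: poly_punctured_poly intro!: prod_zero)

lemma punctured_poly_eq_0_iff:
  "poly (punctured_poly w j) z = 0 \<longleftrightarrow> (\<exists>k. k \<noteq> j \<and> z = w $ k)"
  by (auto simp: poly_punctured_poly)

lemma punctured_poly_own_node:
  fixes w :: "complex ^ 'n"
  assumes "inj (($) w)"
  shows "poly (punctured_poly w i) (w $ i) \<noteq> 0"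
  using assms by (auto simp: punctured_poly_eq_0_iff inj_def)

lemma separation_pos:
  fixes x :: "complex ^ 'n"
  assumes "inj (($) x)" shows "separation x > 0"
  using assms
  unfolding separation_def by (intro prod_pos) (simp add: punctured_poly_own_node)

lemma Lagrange_interpolation:
  fixes x :: "complex ^ 'n"
  assumes "inj (($) x)" and "degree p < CARD('n)"
  shows "poly p t = (\<Sum>l\<in>UNIV. poly (punctured_poly x l) t / poly (punctured_poly x l) (x $ l) * poly p (x $ l))"
proof -
  define L where "L = (\<Sum>l\<in>UNIV. smult (poly p (x $ l) / poly (punctured_poly x l) (x $ l)) (punctured_poly x l))"
  have "p = L"
  proof (rule poly_eqI_degree[where A = "range (($) x)"])
    show "poly p z = poly L z" if "z \<in> range (($) x)" for z
    proof -
      from that obtain i where z: "z = x $ i" by blast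
      have "poly L z = (\<Sum>l\<in>UNIV. if l = i then poly p z else 0)"
        unfolding L_def poly_sum z
        by (intro sum.cong refl) (auto simp: punctured_poly_other_node punctured_poly_own_node[OF assms(1)])
      then show ?thesis by simp
    qed
    have card: "card (range (($) x)) = CARD('n)" using assms(1) by (simp add: card_image)
    with assms(2) show "degree p < card (range (($) x))" by simp
    have "degree L \<le> CARD('n) - 1" unfolding L_def
    proof (rule degree_sum_le)
      fix l
      show "degree (smult (poly p (x $ l) / poly (punctured_poly x l) (x $ l)) (punctured_poly x l)) \<le> CARD('n) - 1"
        using degree_punctured_poly[of x l] degree_smult_le[of _ "punctured_poly x l"]
        by (metis (no_types, lifting) Suc_pred' le_trans less_Suc_eq_le zero_less_card_finite)
    qed simp
    moreover have "CARD('n) > 0" by simp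
    ultimately show "degree L < card (range (($) x))" unfolding card by linarith
  qed
  then have "poly p t = poly L t" by simp
  then show ?thesis by (simp add: L_def poly_sum mult.commute)
qed

definition eval_matrix :: "('n \<Rightarrow> complex poly) \<Rightarrow> complex ^ 'n \<Rightarrow> complex ^ 'n ^ 'n" where
  "eval_matrix p x = (\<chi> i j. poly (p j) (x $ i))"

definition replace_entry :: "complex ^ 'n \<Rightarrow> 'n \<Rightarrow> complex \<Rightarrow> complex ^ 'n" where
  "replace_entry x i t = (\<chi> k. if k = i then t else x $ k)"

lemma punctured_poly_replace_entry: "punctured_poly (replace_entry x i t) i = punctured_poly x i"
  unfolding punctured_poly_def replace_entry_def by (intro prod.cong) auto

text \<open>
  Lagrange interpolation at the old nodes writes the row of the new node \<open>t\<close> as a combination of the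
  old rows. The rows other than row \<open>i\<close> are still present and do not contribute to the determinant, so
  that it is only multiplied by the value at \<open>t\<close> of the Lagrange polynomial of node \<open>i\<close>.
\<close>

lemma det_eval_matrix_replace_entry:
  fixes x :: "complex ^ 'n"
  assumes inj: "inj (($) x)" and deg: "\<And>j. degree (p j) < CARD('n)"
  shows "det (eval_matrix p (replace_entry x i t)) * poly (punctured_poly x i) (x $ i) =
         det (eval_matrix p x) * poly (punctured_poly x i) t"
proof -
  let ?A = "eval_matrix p x"
  define c where "c l = poly (punctured_poly x l) t / poly (punctured_poly x l) (x $ l)" for l
  define y where "y = (\<Sum>l\<in>UNIV - {i}. c l *s row l ?A)"
  have row: "row l ?A = (\<chi> j. poly (p j) (x $ l))" for l
    by (simp add: row_def eval_matrix_def vec_eq_iff)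
  have y: "y \<in> vec.span {row j ?A | j. j \<noteq> i}"
    unfolding y_def by (intro vec.span_sum vec.span_scale vec.span_base) auto
  have new_row: "(\<chi> j. poly (p j) t) = c i *s row i ?A + y"
  proof -
    have "poly (p j) t = c i * poly (p j) (x $ i) + (\<Sum>l\<in>UNIV - {i}. c l * poly (p j) (x $ l))" for j
      using Lagrange_interpolation[OF inj deg, of j t]
      by (simp add: c_def sum.remove[of UNIV i])
    then show ?thesis by (simp add: vec_eq_iff y_def row)
  qed
  let ?C = "\<chi> k. if k = i then c i *s row i ?A else row k ?A"
  have rC: "row i ?C = c i *s row i ?A" "row k ?C = row k ?A" if "k \<noteq> i" for k
    using that by (simp_all add: row_def vec_eq_iff)
  \<comment> \<open>The span lemma adds to row \<open>i\<close> of a matrix, hence the detour through the matrix with row \<open>i\<close> scaled.\<close>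
  have rCi: "row i ?C = c i *s row i ?A" by (simp add: row_def vec_eq_iff)
  have "{row j ?C | j. j \<noteq> i} = {row j ?A | j. j \<noteq> i}"
    using rC(2) by (intro Collect_cong ex_cong1) auto
  with y have yC: "y \<in> vec.span {row j ?C | j. j \<noteq> i}" by simp
  have "eval_matrix p (replace_entry x i t) = (\<chi> k. if k = i then row i ?C + y else row k ?C)"
  proof -
    have "eval_matrix p (replace_entry x i t) $ k = (if k = i then row i ?C + y else row k ?C)" for k
    proof (cases "k = i")
      case True
      then show ?thesis using new_row
        by (simp add: rCi) (simp add: eval_matrix_def replace_entry_def)
    next
      case False
      then show ?thesis by (simp only: rC(2)[OF False] False if_False) (simp add: False row_def eval_matrix_def replace_entry_def)
    qed
    then show ?thesis by (subst vec_eq_iff) simp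
  qed
  then have "det (eval_matrix p (replace_entry x i t)) = det ?C"
    using det_row_span[OF yC] by simp
  also have "\<dots> = c i * det (\<chi> k. if k = i then row i ?A else row k ?A)"
    by (rule det_row_mul)
  also have "(\<chi> k. if k = i then row i ?A else row k ?A) = ?A"
    by (simp add: row_def eval_matrix_def vec_eq_iff)
  finally show ?thesis
    using punctured_poly_own_node[OF inj, of i] by (simp add: c_def)
qed

text \<open>Isolates the dependence on \<open>x\<^sub>i\<close>: the double product does not contain this node.\<close>

lemma separation_split:
  "separation x = (cmod (poly (punctured_poly x i) (x $ i)))\<^sup>2 *
     (\<Prod>k\<in>UNIV - {i}. \<Prod>l\<in>UNIV - {k, i}. cmod (x $ k - x $ l))"
proof -
  have "cmod (poly (punctured_poly x k) (x $ k)) =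
      cmod (x $ i - x $ k) * (\<Prod>l\<in>UNIV - {k, i}. cmod (x $ k - x $ l))" if "k \<noteq> i" for k
  proof -
    have "UNIV - {k} - {i} = UNIV - {k, i}" by auto
    then show ?thesis using that
      by (simp add: poly_punctured_poly prod.remove[of "UNIV - {k}" i] norm_mult prod_norm
          norm_minus_commute[of "x $ k" "x $ i"])
  qed
  then have "(\<Prod>k\<in>UNIV - {i}. cmod (poly (punctured_poly x k) (x $ k))) =
      cmod (poly (punctured_poly x i) (x $ i)) *
      (\<Prod>k\<in>UNIV - {i}. \<Prod>l\<in>UNIV - {k, i}. cmod (x $ k - x $ l))"
    by (simp add: prod.distrib poly_punctured_poly prod_norm)
  then show ?thesis
    by (simp add: separation_def prod.remove[of UNIV i] power2_eq_square)
qed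

lemma separation_replace_entry:
  "separation (replace_entry x i t) * (cmod (poly (punctured_poly x i) (x $ i)))\<^sup>2 =
   separation x * (cmod (poly (punctured_poly x i) t))\<^sup>2"
proof -
  have "(\<Prod>k\<in>UNIV - {i}. \<Prod>l\<in>UNIV - {k, i}. cmod (replace_entry x i t $ k - replace_entry x i t $ l)) =
        (\<Prod>k\<in>UNIV - {i}. \<Prod>l\<in>UNIV - {k, i}. cmod (x $ k - x $ l))"
    by (intro prod.cong refl) (auto simp: replace_entry_def)
  moreover have "replace_entry x i t $ i = t" by (simp add: replace_entry_def)
  ultimately show ?thesis
    unfolding separation_split[of "replace_entry x i t" i] separation_split[of x i]
      punctured_poly_replace_entry by simp
qed

lemma det_separation_replace_entry:
  fixes x :: "complex ^ 'n"
  assumes inj: "inj (($) x)" and deg: "\<And>j. degree (p j) < CARD('n)"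
  shows "(cmod (det (eval_matrix p (replace_entry x i t))))\<^sup>2 * separation x =
         (cmod (det (eval_matrix p x)))\<^sup>2 * separation (replace_entry x i t)"
proof -
  let ?a = "cmod (poly (punctured_poly x i) (x $ i))" and ?b = "cmod (poly (punctured_poly x i) t)"
  let ?x' = "replace_entry x i t"
  have "cmod (det (eval_matrix p ?x')) * ?a = cmod (det (eval_matrix p x)) * ?b"
    unfolding norm_mult[symmetric] det_eval_matrix_replace_entry[OF assms] ..
  then have d: "(cmod (det (eval_matrix p ?x')))\<^sup>2 * ?a\<^sup>2 = (cmod (det (eval_matrix p x)))\<^sup>2 * ?b\<^sup>2"
    by (metis power_mult_distrib)
  have "(cmod (det (eval_matrix p ?x')))\<^sup>2 * separation x * ?a\<^sup>2 =
        (cmod (det (eval_matrix p x)))\<^sup>2 * (separation x * ?b\<^sup>2)"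
    using d by algebra
  also have "\<dots> = (cmod (det (eval_matrix p x)))\<^sup>2 * separation ?x' * ?a\<^sup>2"
    using separation_replace_entry[of x i t] by algebra
  finally show ?thesis using punctured_poly_own_node[OF inj, of i] by simp
qed

lemma det_separation_disjoint:
  fixes x y :: "complex ^ 'n"
  assumes x: "inj (($) x)" and y: "inj (($) y)" and disjoint: "\<And>i j. x $ i \<noteq> y $ j"
    and deg: "\<And>j. degree (p j) < CARD('n)"
  shows "(cmod (det (eval_matrix p y)))\<^sup>2 * separation x = (cmod (det (eval_matrix p x)))\<^sup>2 * separation y"
proof -
  define z where "z S = (\<chi> k. if k \<in> S then y $ k else x $ k)" for S
  have inj_z: "inj (($) (z S))" for S
  proof (rule injI)
    fix i j assume "z S $ i = z S $ j"
    then show "i = j"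
      using disjoint[of i j] disjoint[of j i]
      by (simp add: z_def inj_eq[OF x] inj_eq[OF y] split: if_splits)
  qed
  have "(cmod (det (eval_matrix p (z S))))\<^sup>2 * separation x = (cmod (det (eval_matrix p x)))\<^sup>2 * separation (z S)"
    if "finite S" for S
    using that
  proof (induction S rule: finite_induct)
    case empty
    then show ?case by (simp add: z_def)
  next
    case (insert i S)
    have z': "z (insert i S) = replace_entry (z S) i (y $ i)"
      by (simp add: z_def replace_entry_def vec_eq_iff)
    have "(cmod (det (eval_matrix p (z (insert i S)))))\<^sup>2 * separation (z S) =
          (cmod (det (eval_matrix p (z S))))\<^sup>2 * separation (z (insert i S))"
      unfolding z' by (rule det_separation_replace_entry[OF inj_z deg])
    then have "(cmod (det (eval_matrix p (z (insert i S)))))\<^sup>2 * separation x * separation (z S) =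
          (cmod (det (eval_matrix p x)))\<^sup>2 * separation (z (insert i S)) * separation (z S)"
      using insert.IH by algebra
    then show ?case using separation_pos[OF inj_z, of S] by simp
  qed
  from this[of UNIV] show ?thesis by (simp add: z_def)
qed

text \<open>
  For polynomials of degree less than the number of nodes, the evaluation determinant is a fixed
  multiple of the Vandermonde determinant of the nodes. Moving one node at a time rescales both by the
  same factor. Along the way the nodes must stay distinct, which a detour through a third set of nodes
  ensures.
\<close>

lemma det_eval_matrix_separation:
  fixes x w :: "complex ^ 'n"
  assumes x: "inj (($) x)" and w: "inj (($) w)" and deg: "\<And>j. degree (p j) < CARD('n)"
  shows "(cmod (det (eval_matrix p x)))\<^sup>2 * separation w = (cmod (det (eval_matrix p w)))\<^sup>2 * separation x"
proof -
  let ?X = "range (($) x) \<union> range (($) w)"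
  have "infinite (- ?X)"
    by (simp add: Compl_eq_Diff_UNIV Diff_infinite_finite infinite_UNIV_char_0)
  then obtain Y where Y: "finite Y" "card Y = CARD('n)" "Y \<subseteq> - ?X"
    using infinite_arbitrarily_large by blast
  obtain h where h: "bij_betw h (UNIV :: 'n set) Y"
    using finite_same_card_bij[of "UNIV :: 'n set" Y] Y by auto
  define y :: "complex ^ 'n" where "y = (\<chi> k. h k)"
  have hY: "h k \<in> Y" for k using h bij_betwE by blast
  have y: "inj (($) y)" using h by (auto simp: y_def bij_betw_def inj_def)
  have xy: "x $ i \<noteq> y $ j" "w $ i \<noteq> y $ j" for i j
    using subsetD[OF Y(3) hY[of j]] unfolding y_def vec_lambda_beta by (metis rangeI Compl_iff UnI1 UnI2)+
  note xy = det_separation_disjoint[where p = p, OF x y xy(1) deg]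
    det_separation_disjoint[where p = p, OF w y xy(2) deg]
  have "(cmod (det (eval_matrix p x)))\<^sup>2 * separation w * separation y =
        (cmod (det (eval_matrix p w)))\<^sup>2 * separation x * separation y"
    using xy by algebra
  then show ?thesis using separation_pos[OF y] by simp
qed

section \<open>Extremal configurations on the circle\<close>

text \<open>
  The matrix \<open>p\<^sub>j(x\<^sub>i)\<close> has rows of squared norm \<open>F(x\<^sub>i)\<close> and is diagonal at \<open>x = w\<close>, so that
  Hadamard's inequality at \<open>x\<close> meets an equality at \<open>w\<close>. The two determinants are related through
  the Vandermonde determinants.
\<close>

lemma sum_of_squares_extremal:
  fixes w x :: "complex ^ 'n"
  assumes w: "inj (($) w)" and x: "inj (($) x)"
    and deg: "\<And>j. degree (p j) < CARD('n)"
    and diag: "\<And>i j. i \<noteq> j \<longrightarrow> poly (p j) (w $ i) = 0" "\<And>i. poly (p i) (w $ i) \<noteq> 0"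
    and F: "\<And>z. F z = (\<Sum>j\<in>UNIV. (cmod (poly (p j) z))\<^sup>2)"
  shows "(\<Prod>i\<in>UNIV. F (w $ i)) * separation x \<le> (\<Prod>i\<in>UNIV. F (x $ i)) * separation w"
    and "(\<Prod>i\<in>UNIV. F (w $ i)) * separation x = (\<Prod>i\<in>UNIV. F (x $ i)) * separation w \<Longrightarrow>
      i \<noteq> k \<Longrightarrow> (\<Sum>j\<in>UNIV. poly (p j) (x $ i) * cnj (poly (p j) (x $ k))) = 0"
proof -
  have norm_row: "(norm (eval_matrix p y $ i))\<^sup>2 = F (y $ i)" for y :: "complex ^ 'n" and i
    by (simp add: F norm_vec_def L2_set_def eval_matrix_def sum_nonneg)
  have "det (eval_matrix p w) = (\<Prod>i\<in>UNIV. poly (p i) (w $ i))"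
    by (subst det_diagonal) (simp_all add: eval_matrix_def diag)
  moreover have "F (w $ i) = (cmod (poly (p i) (w $ i)))\<^sup>2" for i
  proof -
    have "F (w $ i) = (\<Sum>j\<in>UNIV. if j = i then (cmod (poly (p i) (w $ i)))\<^sup>2 else 0)"
      unfolding F by (intro sum.cong refl) (use diag(1) in auto)
    then show ?thesis by simp
  qed
  ultimately have det_w: "(cmod (det (eval_matrix p w)))\<^sup>2 = (\<Prod>i\<in>UNIV. F (w $ i))"
    by (simp add: prod_norm[symmetric] prod_power_distrib)
  have det_w_nz: "det (eval_matrix p w) \<noteq> 0"
    using \<open>det (eval_matrix p w) = _\<close> diag(2) by simp
  have rel: "(cmod (det (eval_matrix p x)))\<^sup>2 * separation w = (\<Prod>i\<in>UNIV. F (w $ i)) * separation x"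
    using det_eval_matrix_separation[where p = p, OF x w deg] det_w by simp
  have rows: "(\<Prod>i\<in>UNIV. norm (eval_matrix p x $ i))\<^sup>2 = (\<Prod>i\<in>UNIV. F (x $ i))"
    by (simp add: prod_power_distrib norm_row)
  have "(cmod (det (eval_matrix p x)))\<^sup>2 \<le> (\<Prod>i\<in>UNIV. F (x $ i))"
    unfolding rows[symmetric] by (intro power_mono Hadamard_inequality) simp
  then show "(\<Prod>i\<in>UNIV. F (w $ i)) * separation x \<le> (\<Prod>i\<in>UNIV. F (x $ i)) * separation w"
    unfolding rel[symmetric] using separation_pos[OF w] by (intro mult_right_mono) auto
  assume eq: "(\<Prod>i\<in>UNIV. F (w $ i)) * separation x = (\<Prod>i\<in>UNIV. F (x $ i)) * separation w"
    and ik: "i \<noteq> k"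
  have "(cmod (det (eval_matrix p x)))\<^sup>2 = (\<Prod>i\<in>UNIV. norm (eval_matrix p x $ i))\<^sup>2"
    using eq separation_pos[OF w] unfolding rows rel[symmetric] by simp
  then have "cmod (det (eval_matrix p x)) = (\<Prod>i\<in>UNIV. norm (eval_matrix p x $ i))"
    by (simp add: power2_eq_iff_nonneg prod_nonneg)
  moreover have "det (eval_matrix p x) \<noteq> 0"
    using rel det_w det_w_nz separation_pos[OF x] by (metis less_irrefl mult_eq_0_iff norm_eq_zero power_eq_0_iff zero_power2)
  ultimately have "orthogonal_row (eval_matrix p x) k" by (rule Hadamard_equality)
  then show "(\<Sum>j\<in>UNIV. poly (p j) (x $ i) * cnj (poly (p j) (x $ k))) = 0"
    using ik by (simp add: orthogonal_row_def hermitian_inner_def eval_matrix_def)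
qed

lemma prod_linear_factors_dvd:
  fixes p :: "complex poly"
  assumes "finite K" "inj_on z K" "\<And>k. k \<in> K \<Longrightarrow> poly p (z k) = 0"
  shows "(\<Prod>k\<in>K. [:- z k, 1:]) dvd p"
  using assms
proof (induction K arbitrary: p rule: finite_induct)
  case empty
  then show ?case by simp
next
  case (insert a K)
  then obtain q where q: "p = [:- z a, 1:] * q" by (metis insertI1 poly_eq_0_iff_dvd dvdE)
  have "(\<Prod>k\<in>K. [:- z k, 1:]) dvd q"
  proof (rule insert.IH)
    show "poly q (z k) = 0" if "k \<in> K" for k
    proof -
      have "z k \<noteq> z a" using insert.prems(1) insert.hyps(2) that by (auto simp: inj_on_def)
      moreover have "poly p (z k) = 0" using insert.prems(2) that by blast
      ultimately show ?thesis by (simp add: q)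
    qed
  qed (use insert.prems in \<open>auto simp: inj_on_def\<close>)
  then show ?case using insert.hyps by (simp add: q mult_dvd_mono del: mult_pCons_left)
qed

lemma pderiv_sum: "pderiv (sum f A) = (\<Sum>a\<in>A. pderiv (f a))"
  by (induction A rule: infinite_finite_induct) (simp_all add: pderiv_add)

text \<open>
  For distinct \<open>w\<^sub>k\<close> the residue of \<open>R / \<Prod>\<^sub>k (z - w\<^sub>k)\<^sup>2\<close> at \<open>w\<^sub>j\<close> is the derivative of \<open>R / q\<^sub>j\<^sup>2\<close> there,
  where \<open>q\<^sub>j\<close> omits the factor of \<open>w\<^sub>j\<close>; the condition is its vanishing, cleared of denominators.
\<close>

definition residue_free :: "complex poly \<Rightarrow> complex ^ 'n \<Rightarrow> bool" where
  "residue_free R w \<longleftrightarrow> (\<forall>j. poly (pderiv R) (w $ j) * poly (punctured_poly w j) (w $ j) =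
     2 * poly R (w $ j) * poly (pderiv (punctured_poly w j)) (w $ j))"

text \<open>
  This is the partial fraction expansion of \<open>R / \<Prod>\<^sub>k (z - w\<^sub>k)\<^sup>2\<close>: without residues only the double
  poles contribute. In terms of interpolation, both sides have the same values and derivatives at the
  \<open>n\<close> nodes, and their degrees are less than \<open>2 n\<close>.
\<close>

lemma residue_free_expansion:
  fixes w :: "complex ^ 'n"
  assumes w: "inj (($) w)" and deg: "degree R \<le> 2 * (CARD('n) - 1)" and free: "residue_free R w"
  shows "R = (\<Sum>j\<in>UNIV. smult (poly R (w $ j) / (poly (punctured_poly w j) (w $ j))\<^sup>2) ((punctured_poly w j)\<^sup>2))"
proof -
  let ?q = "punctured_poly w"
  define S where "S = (\<Sum>j\<in>UNIV. smult (poly R (w $ j) / (poly (?q j) (w $ j))\<^sup>2) ((?q j)\<^sup>2))"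
  define N where "N = (\<Prod>k\<in>UNIV. [:- (w $ k), 1:])"
  define D where "D = R - S"
  have n: "CARD('n) > 0" by simp
  have nz: "poly (?q j) (w $ j) \<noteq> 0" for j by (rule punctured_poly_own_node[OF w])
  have S_val: "poly S (w $ i) = poly R (w $ i)" for i
  proof -
    have "poly S (w $ i) = (\<Sum>j\<in>UNIV. if j = i then poly R (w $ i) else 0)"
      unfolding S_def poly_sum
      by (intro sum.cong refl) (auto simp: punctured_poly_other_node nz power2_eq_square)
    then show ?thesis by simp
  qed
  have S_der: "poly (pderiv S) (w $ i) = poly (pderiv R) (w $ i)" for i
  proof -
    have "poly (pderiv S) (w $ i) = (\<Sum>j\<in>UNIV. if j = i then poly (pderiv R) (w $ i) else 0)"
      unfolding S_def pderiv_sum poly_sum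
    proof (intro sum.cong refl)
      fix j
      have "poly (pderiv R) (w $ i) = 2 * poly R (w $ i) * poly (pderiv (?q i)) (w $ i) / poly (?q i) (w $ i)"
        using free nz[of i] by (simp add: residue_free_def field_simps)
      then show "poly (pderiv (smult (poly R (w $ j) / (poly (?q j) (w $ j))\<^sup>2) ((?q j)\<^sup>2))) (w $ i) =
          (if j = i then poly (pderiv R) (w $ i) else 0)"
        by (auto simp: pderiv_smult power2_eq_square pderiv_mult punctured_poly_other_node nz)
    qed
    then show ?thesis by simp
  qed
  have "N dvd D" unfolding N_def
    by (rule prod_linear_factors_dvd) (use w in \<open>auto simp: D_def S_val\<close>)
  then obtain E where E: "D = N * E" by (elim dvdE)
  have N_q: "N = [:- (w $ i), 1:] * ?q i" for i
    unfolding N_def punctured_poly_def by (subst prod.remove[of _ i]) auto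
  have E_val: "poly E (w $ i) = 0" for i
  proof -
    have "poly (pderiv D) (w $ i) = poly (?q i) (w $ i) * poly E (w $ i)"
      unfolding E N_q[of i] by (simp add: pderiv_mult pderiv_pCons del: mult_pCons_left)
    moreover have "poly (pderiv D) (w $ i) = 0" by (simp add: D_def pderiv_diff S_der)
    ultimately show ?thesis using nz[of i] by simp
  qed
  have degS: "degree S \<le> 2 * (CARD('n) - 1)" unfolding S_def
  proof (rule degree_sum_le)
    fix j
    have "degree ((?q j)\<^sup>2) \<le> degree (?q j) * 2" by (rule degree_power_le)
    with degree_punctured_poly[of w j]
    show "degree (smult (poly R (w $ j) / (poly (?q j) (w $ j))\<^sup>2) ((?q j)\<^sup>2)) \<le> 2 * (CARD('n) - 1)"
      using degree_smult_le[of "poly R (w $ j) / (poly (?q j) (w $ j))\<^sup>2" "(?q j)\<^sup>2"] by linarith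
  qed simp
  then have "degree D < 2 * CARD('n)"
    using degree_diff_le_max[of R S] deg n unfolding D_def by linarith
  have "degree N = CARD('n)" unfolding N_def by (subst degree_prod_eq_sum_degree) auto
  have "E = 0"
  proof (rule ccontr)
    assume "E \<noteq> 0"
    moreover have "N \<noteq> 0" using \<open>degree N = CARD('n)\<close> n by (metis degree_0 less_irrefl)
    ultimately have "degree D = CARD('n) + degree E"
      unfolding E using \<open>degree N = CARD('n)\<close> by (simp add: degree_mult_eq)
    with \<open>degree D < _\<close> have "degree E < CARD('n)" by linarith
    moreover have "card (range (($) w)) = CARD('n)" using w by (simp add: card_image)
    ultimately have "E = 0"
      by (intro poly_eqI_degree[where A = "range (($) w)"]) (use E_val n in auto)
    with \<open>E \<noteq> 0\<close> show False by simp
  qed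
  then show ?thesis using E by (simp add: D_def S_def)
qed

lemma unit_circle_diff_squared:
  assumes "cmod x = 1" "cmod w = 1"
  shows "(x - w)\<^sup>2 = - (x * w) * of_real ((cmod (x - w))\<^sup>2)"
proof -
  have xw: "x * cnj x = 1" "w * cnj w = 1"
    using assms complex_norm_square[of x] complex_norm_square[of w] by simp_all
  have "of_real ((cmod (x - w))\<^sup>2) = (x - w) * (cnj x - cnj w)"
    by (simp only: complex_norm_square complex_cnj_diff)
  then show ?thesis using xw by algebra
qed

lemma punctured_poly_squared:
  fixes w :: "complex ^ 'n"
  assumes "cmod x = 1" "\<And>k. cmod (w $ k) = 1"
  shows "(poly (punctured_poly w j) x)\<^sup>2 =
    x ^ (CARD('n) - 1) * (\<Prod>k\<in>UNIV - {j}. - (w $ k)) * of_real ((cmod (poly (punctured_poly w j) x))\<^sup>2)"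
proof -
  have "(poly (punctured_poly w j) x)\<^sup>2 = (\<Prod>k\<in>UNIV - {j}. x * - (w $ k) * of_real ((cmod (x - w $ k))\<^sup>2))"
    unfolding poly_punctured_poly prod_power_distrib
    by (intro prod.cong refl) (simp add: unit_circle_diff_squared[OF assms])
  also have "\<dots> = x ^ (CARD('n) - 1) * (\<Prod>k\<in>UNIV - {j}. - (w $ k)) * of_real ((cmod (poly (punctured_poly w j) x))\<^sup>2)"
    unfolding prod.distrib prod_constant
    by (simp add: poly_punctured_poly prod_norm[symmetric] prod_power_distrib card_Diff_singleton)
  finally show ?thesis .
qed

text \<open>
  On the circle \<open>x\<^sup>-\<^sup>(\<^sup>n\<^sup>-\<^sup>1\<^sup>) R(x)\<close> is then a positive trigonometric polynomial of degree at most \<open>n - 1\<close>.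
\<close>

definition circle_positive :: "nat \<Rightarrow> complex poly \<Rightarrow> bool" where
  "circle_positive n R \<longleftrightarrow> degree R \<le> 2 * (n - 1) \<and>
     (\<forall>x. cmod x = 1 \<longrightarrow> poly R x \<noteq> 0 \<and> poly R x = x ^ (n - 1) * of_real (cmod (poly R x)))"

text \<open>
  On the circle \<open>R(x)\<close> and the squares of the punctured polynomials all have the phase of \<open>x\<^sup>n\<^sup>-\<^sup>1\<close>
  up to a constant, so that dividing the partial fraction expansion by \<open>x\<^sup>n\<^sup>-\<^sup>1\<close> leaves only
  positive terms.
\<close>

lemma residue_free_sum_of_squares:
  fixes w :: "complex ^ 'n"
  assumes w: "inj (($) w)" "\<And>k. cmod (w $ k) = 1"
    and R: "circle_positive CARD('n) R" and free: "residue_free R w" and x: "cmod x = 1"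
  shows "cmod (poly R x) = (\<Sum>j\<in>UNIV. cmod (poly R (w $ j)) / (cmod (poly (punctured_poly w j) (w $ j)))\<^sup>2 *
    (cmod (poly (punctured_poly w j) x))\<^sup>2)"
proof -
  let ?q = "punctured_poly w" and ?n = "CARD('n) - 1"
  define u where "u j = (\<Prod>k\<in>UNIV - {j}. - (w $ k))" for j
  define m where "m j = cmod (poly R (w $ j)) / (cmod (poly (?q j) (w $ j)))\<^sup>2" for j
  have wnz: "w $ k \<noteq> 0" for k using w(2)[of k] by auto
  have unz: "u j \<noteq> 0" for j unfolding u_def using wnz by simp
  have sq: "(poly (?q j) z)\<^sup>2 = z ^ ?n * u j * of_real ((cmod (poly (?q j) z))\<^sup>2)" if "cmod z = 1" for j z
    unfolding u_def by (rule punctured_poly_squared[OF that w(2)])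
  have pos: "poly R z = z ^ ?n * of_real (cmod (poly R z))" if "cmod z = 1" for z
    using R that by (auto simp: circle_positive_def)
  have coeff: "poly R (w $ j) / (poly (?q j) (w $ j))\<^sup>2 = of_real (m j) / u j" for j
    unfolding sq[OF w(2)] by (subst pos[OF w(2)]) (simp add: wnz m_def)
  have "R = (\<Sum>j\<in>UNIV. smult (poly R (w $ j) / (poly (?q j) (w $ j))\<^sup>2) ((?q j)\<^sup>2))"
    using residue_free_expansion[OF w(1) _ free] R by (simp add: circle_positive_def)
  then have "poly R x = poly (\<Sum>j\<in>UNIV. smult (poly R (w $ j) / (poly (?q j) (w $ j))\<^sup>2) ((?q j)\<^sup>2)) x"
    by simp
  also have "\<dots> = (\<Sum>j\<in>UNIV. of_real (m j) / u j * (poly (?q j) x)\<^sup>2)"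
    by (simp only: poly_sum poly_smult poly_power coeff)
  also have "\<dots> = (\<Sum>j\<in>UNIV. x ^ ?n * of_real (m j * (cmod (poly (?q j) x))\<^sup>2))"
    unfolding sq[OF x] using unz by (intro sum.cong refl) simp
  also have "\<dots> = x ^ ?n * of_real (\<Sum>j\<in>UNIV. m j * (cmod (poly (?q j) x))\<^sup>2)"
    by (simp add: sum_distrib_left)
  finally have "poly R x = x ^ ?n * of_real (\<Sum>j\<in>UNIV. m j * (cmod (poly (?q j) x))\<^sup>2)" .
  with pos[OF x] have "x ^ ?n * of_real (cmod (poly R x)) = x ^ ?n * of_real (\<Sum>j\<in>UNIV. m j * (cmod (poly (?q j) x))\<^sup>2)"
    by (rule trans[OF sym])
  moreover have "x ^ ?n \<noteq> 0" using x by auto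
  ultimately have "cmod (poly R x) = (\<Sum>j\<in>UNIV. m j * (cmod (poly (?q j) x))\<^sup>2)"
    by (simp only: mult_cancel_left of_real_eq_iff simp_thms)
  then show ?thesis by (simp add: m_def)
qed

text \<open>
  The sum of squares makes \<open>w\<close> extremal. In the case of equality the matrix rows at the points of \<open>x\<close>
  are pairwise orthogonal. If \<open>x\<^sub>i\<close> is one of the \<open>w\<^sub>l\<close>, its row is supported in column \<open>l\<close>, so that the
  polynomial of column \<open>l\<close> vanishes at every other \<open>x\<^sub>k\<close>; its zeros are the other points of \<open>w\<close>.
\<close>

theorem residue_free_extremal:
  fixes w x :: "complex ^ 'n"
  assumes w: "inj (($) w)" "\<And>k. cmod (w $ k) = 1" and x: "inj (($) x)" "\<And>k. cmod (x $ k) = 1"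
    and R: "circle_positive CARD('n) R" and free: "residue_free R w"
  shows residue_free_minimal:
      "(\<Prod>i\<in>UNIV. cmod (poly R (w $ i))) * separation x \<le> (\<Prod>i\<in>UNIV. cmod (poly R (x $ i))) * separation w"
    and residue_free_minimal_unique:
      "(\<Prod>i\<in>UNIV. cmod (poly R (w $ i))) * separation x = (\<Prod>i\<in>UNIV. cmod (poly R (x $ i))) * separation w \<Longrightarrow>
       x $ i = w $ l \<Longrightarrow> range (($) x) \<subseteq> range (($) w)"
proof -
  let ?q = "punctured_poly w"
  define m where "m j = cmod (poly R (w $ j)) / (cmod (poly (?q j) (w $ j)))\<^sup>2" for j
  have nz: "poly (?q j) (w $ j) \<noteq> 0" for j by (rule punctured_poly_own_node[OF w(1)])
  have m: "m j > 0" for j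
    using R w(2)[of j] nz[of j] by (auto simp: m_def circle_positive_def)
  define p where "p j = smult (of_real (sqrt (m j))) (?q j)" for j
  define F where "F z = (\<Sum>j\<in>UNIV. (cmod (poly (p j) z))\<^sup>2)" for z
  have F: "F z = cmod (poly R z)" if "cmod z = 1" for z
    unfolding residue_free_sum_of_squares[OF w R free that] F_def p_def
    by (intro sum.cong refl) (use m in \<open>simp add: norm_mult power_mult_distrib m_def[symmetric] less_imp_le\<close>)
  have deg: "degree (p j) < CARD('n)" for j
    unfolding p_def using degree_punctured_poly[of w j] degree_smult_le le_less_trans by blast
  have diag: "i \<noteq> j \<longrightarrow> poly (p j) (w $ i) = 0" for i j
    by (simp add: p_def punctured_poly_other_node)
  have pnz: "poly (p j) z = 0 \<longleftrightarrow> poly (?q j) z = 0" for j z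
    using m[of j] by (simp add: p_def)
  have diag': "poly (p i) (w $ i) \<noteq> 0" for i by (simp add: pnz nz)
  note ext = sum_of_squares_extremal[where p = p and F = F, OF w(1) x(1) deg diag diag' F_def,
      unfolded F[OF w(2)] F[OF x(2)]]
  show "(\<Prod>i\<in>UNIV. cmod (poly R (w $ i))) * separation x \<le> (\<Prod>i\<in>UNIV. cmod (poly R (x $ i))) * separation w"
    by (rule ext(1))
  assume eq: "(\<Prod>i\<in>UNIV. cmod (poly R (w $ i))) * separation x = (\<Prod>i\<in>UNIV. cmod (poly R (x $ i))) * separation w"
    and il: "x $ i = w $ l"
  have "x $ k \<in> range (($) w)" for k
  proof (cases "k = i")
    case False
    have "0 = (\<Sum>j\<in>UNIV. poly (p j) (x $ i) * cnj (poly (p j) (x $ k)))"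
      using ext(2)[OF eq] False by (metis (no_types, lifting))
    also have "\<dots> = (\<Sum>j\<in>UNIV. if j = l then poly (p l) (w $ l) * cnj (poly (p l) (x $ k)) else 0)"
      unfolding il by (intro sum.cong refl) (use diag in auto)
    finally have "poly (p l) (x $ k) = 0" using diag' by simp
    then show ?thesis by (auto simp: pnz punctured_poly_eq_0_iff)
  qed (use il in auto)
  then show "range (($) x) \<subseteq> range (($) w)" by auto
qed

section \<open>The Wronskian of a Blaschke product\<close>

definition blaschke_numer :: "complex ^ 'n \<Rightarrow> complex poly" where
  "blaschke_numer a = (\<Prod>j\<in>UNIV. [:- (a $ j), 1:])"

definition blaschke_denom :: "complex ^ 'n \<Rightarrow> complex poly" where
  "blaschke_denom a = (\<Prod>j\<in>UNIV. [:1, - cnj (a $ j):])"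

definition wronskian :: "complex poly \<Rightarrow> complex poly \<Rightarrow> complex poly" where
  "wronskian p s = pderiv p * s - p * pderiv s"

abbreviation blaschke_wronskian :: "complex ^ 'n \<Rightarrow> complex poly" where
  "blaschke_wronskian a \<equiv> wronskian (blaschke_numer a) (blaschke_denom a)"

lemma poly_blaschke_denom: "poly (blaschke_denom a) z = (\<Prod>j\<in>UNIV. 1 - cnj (a $ j) * z)"
  by (simp add: blaschke_denom_def poly_prod mult.commute)

lemma poly_blaschke_numer: "poly (blaschke_numer a) z = (\<Prod>j\<in>UNIV. z - a $ j)"
  by (simp add: blaschke_numer_def poly_prod)

lemma blaschke_eq_ratio: "blaschke a z = poly (blaschke_numer a) z / poly (blaschke_denom a) z"
  by (simp add: blaschke_def poly_blaschke_numer poly_blaschke_denom prod_dividef)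

lemma blaschke_denom_nonzero:
  fixes a :: "complex ^ 'n"
  assumes a: "\<And>j. a $ j \<in> ball 0 1" and z: "cmod z \<le> 1"
  shows "poly (blaschke_denom a) z \<noteq> 0"
proof -
  have "1 - cnj (a $ j) * z \<noteq> 0" for j
  proof
    assume "1 - cnj (a $ j) * z = 0"
    then have "cmod (a $ j) * cmod z = 1" by (metis complex_mod_cnj norm_mult norm_one right_minus_eq)
    moreover have "cmod (a $ j) * cmod z \<le> cmod (a $ j)" using z by (simp add: mult_left_le)
    moreover have "cmod (a $ j) < 1" using a[of j] by simp
    ultimately show False by simp
  qed
  then show ?thesis by (simp add: poly_blaschke_denom)
qed

lemma deriv_blaschke:
  assumes "poly (blaschke_denom a) z \<noteq> 0"
  shows "deriv (blaschke a) z = poly (blaschke_wronskian a) z / (poly (blaschke_denom a) z)\<^sup>2"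
proof -
  have "((\<lambda>z. poly (blaschke_numer a) z / poly (blaschke_denom a) z) has_field_derivative
      (poly (pderiv (blaschke_numer a)) z * poly (blaschke_denom a) z -
       poly (blaschke_numer a) z * poly (pderiv (blaschke_denom a)) z) /
      (poly (blaschke_denom a) z * poly (blaschke_denom a) z)) (at z)"
    by (intro DERIV_divide poly_DERIV assms)
  then show ?thesis
    unfolding blaschke_eq_ratio[abs_def]
    by (simp add: DERIV_imp_deriv wronskian_def power2_eq_square)
qed

text \<open>
  Division by \<open>P S\<close> turns the Wronskian into \<open>P'/P - S'/S\<close>, to which a zero \<open>a\<close> of \<open>B\<close> contributes
  \<open>(1 - |a|\<^sup>2) / ((z - a) (1 - cnj a z))\<close>.
\<close>

lemma blaschke_wronskian_sum:
  fixes a :: "complex ^ 'n"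
  shows "blaschke_wronskian a = (\<Sum>j\<in>UNIV. smult (1 - a $ j * cnj (a $ j))
    (\<Prod>k\<in>UNIV - {j}. [:- (a $ k), 1:] * [:1, - cnj (a $ k):]))"
proof -
  let ?p = "\<lambda>j. [:- (a $ j), 1:]" and ?s = "\<lambda>j. [:1, - cnj (a $ j):]"
  have "blaschke_wronskian a = (\<Sum>j\<in>UNIV. prod ?p (UNIV - {j}) * pderiv (?p j) * blaschke_denom a -
      blaschke_numer a * (prod ?s (UNIV - {j}) * pderiv (?s j)))"
    unfolding wronskian_def sum_subtractf sum_distrib_left[symmetric] sum_distrib_right[symmetric]
    by (simp only: blaschke_numer_def blaschke_denom_def pderiv_prod)
  also have "\<dots> = (\<Sum>j\<in>UNIV. smult (1 - a $ j * cnj (a $ j)) (\<Prod>k\<in>UNIV - {j}. ?p k * ?s k))"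
  proof (intro sum.cong refl)
    fix j
    have n: "blaschke_numer a = ?p j * prod ?p (UNIV - {j})" "blaschke_denom a = ?s j * prod ?s (UNIV - {j})"
      unfolding blaschke_numer_def blaschke_denom_def by (subst prod.remove[of _ j]; simp)+
    have "pderiv (?p j) * ?s j - ?p j * pderiv (?s j) = [:1 - a $ j * cnj (a $ j):]"
      by (simp add: pderiv_pCons)
    moreover have "A * p' * (s * B) - p * A * (B * s') = (p' * s - p * s') * (A * B)"
      for A B p p' s s' :: "complex poly"
      by (simp add: algebra_simps)
    ultimately have "prod ?p (UNIV - {j}) * pderiv (?p j) * blaschke_denom a -
        blaschke_numer a * (prod ?s (UNIV - {j}) * pderiv (?s j)) =
        [:1 - a $ j * cnj (a $ j):] * (prod ?p (UNIV - {j}) * prod ?s (UNIV - {j}))"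
      unfolding n by (simp only:)
    then show "prod ?p (UNIV - {j}) * pderiv (?p j) * blaschke_denom a -
        blaschke_numer a * (prod ?s (UNIV - {j}) * pderiv (?s j)) =
        smult (1 - a $ j * cnj (a $ j)) (\<Prod>k\<in>UNIV - {j}. ?p k * ?s k)"
      unfolding prod.distrib by simp
  qed
  finally show ?thesis .
qed

text \<open>
  On the circle \<open>(x - a) (1 - cnj a x) = x |x - a|\<^sup>2\<close>, so every summand of the previous formula has
  the phase of \<open>x\<^sup>n\<^sup>-\<^sup>1\<close>.
\<close>

lemma circle_positive_blaschke_wronskian:
  fixes a :: "complex ^ 'n"
  assumes a: "\<And>j. a $ j \<in> ball 0 1"
  shows "circle_positive CARD('n) (blaschke_wronskian a)"
  unfolding circle_positive_def
proof (intro conjI allI impI)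
  let ?R = "blaschke_wronskian a"
  let ?f = "\<lambda>k. [:- (a $ k), 1:] * [:1, - cnj (a $ k):]"
  show "degree ?R \<le> 2 * (CARD('n) - 1)" unfolding blaschke_wronskian_sum
  proof (rule degree_sum_le)
    fix j
    have "degree (prod ?f (UNIV - {j})) \<le> (\<Sum>k\<in>UNIV - {j}. degree (?f k))"
      using degree_prod_sum_le[of "UNIV - {j}" ?f] by (simp add: o_def)
    also have "\<dots> \<le> (\<Sum>k\<in>UNIV - {j}. 2)"
    proof (rule sum_mono)
      fix k
      show "degree (?f k) \<le> 2"
        using degree_mult_le[of "[:- (a $ k), 1:]" "[:1, - cnj (a $ k):]"]
          degree_pCons_le[of 1 "[:- cnj (a $ k):]"] by simp
    qed
    also have "\<dots> = 2 * (CARD('n) - 1)" by (simp add: card_Diff_singleton)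
    finally show "degree (smult (1 - a $ j * cnj (a $ j)) (prod ?f (UNIV - {j}))) \<le> 2 * (CARD('n) - 1)"
      using degree_smult_le le_trans by blast
  qed simp
  fix x assume x: "cmod x = 1"
  define r where "r = (\<Sum>j\<in>UNIV. (1 - (cmod (a $ j))\<^sup>2) * (\<Prod>k\<in>UNIV - {j}. (cmod (x - a $ k))\<^sup>2))"
  have xnz: "x \<noteq> 0" using x by auto
  have f: "poly (?f k) x = x * of_real ((cmod (x - a $ k))\<^sup>2)" for k
  proof -
    have "x * cnj x = 1" using x complex_norm_square[of x] by simp
    moreover have "of_real ((cmod (x - a $ k))\<^sup>2) = (x - a $ k) * (cnj x - cnj (a $ k))"
      by (simp only: complex_norm_square complex_cnj_diff)
    moreover have "poly (?f k) x = (x - a $ k) * (1 - cnj (a $ k) * x)"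
      by (simp add: algebra_simps)
    ultimately show ?thesis by algebra
  qed
  have "poly ?R x = (\<Sum>j\<in>UNIV. (1 - a $ j * cnj (a $ j)) * (\<Prod>k\<in>UNIV - {j}. x * of_real ((cmod (x - a $ k))\<^sup>2)))"
    unfolding blaschke_wronskian_sum poly_sum poly_smult poly_prod f ..
  also have "\<dots> = (\<Sum>j\<in>UNIV. x ^ (CARD('n) - 1) *
      of_real ((1 - (cmod (a $ j))\<^sup>2) * (\<Prod>k\<in>UNIV - {j}. (cmod (x - a $ k))\<^sup>2)))"
  proof (intro sum.cong refl)
    fix j
    have "1 - a $ j * cnj (a $ j) = of_real (1 - (cmod (a $ j))\<^sup>2)"
      by (simp only: complex_norm_square[symmetric] of_real_diff of_real_1)
    moreover have "(\<Prod>k\<in>UNIV - {j}. x * of_real ((cmod (x - a $ k))\<^sup>2)) =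
        x ^ (CARD('n) - 1) * of_real (\<Prod>k\<in>UNIV - {j}. (cmod (x - a $ k))\<^sup>2)"
      unfolding prod.distrib prod_constant by (simp add: card_Diff_singleton)
    ultimately show "(1 - a $ j * cnj (a $ j)) * (\<Prod>k\<in>UNIV - {j}. x * of_real ((cmod (x - a $ k))\<^sup>2)) =
        x ^ (CARD('n) - 1) * of_real ((1 - (cmod (a $ j))\<^sup>2) * (\<Prod>k\<in>UNIV - {j}. (cmod (x - a $ k))\<^sup>2))"
      by simp
  qed
  also have "\<dots> = x ^ (CARD('n) - 1) * of_real r"
    by (simp add: r_def sum_distrib_left)
  finally have R: "poly ?R x = x ^ (CARD('n) - 1) * of_real r" .
  have "r > 0" unfolding r_def
  proof (rule sum_pos)
    fix j
    have "cmod (a $ j) < 1" using a[of j] by simp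
    then have "(cmod (a $ j))\<^sup>2 < 1" by (simp add: abs_square_less_1)
    moreover have "(\<Prod>k\<in>UNIV - {j}. (cmod (x - a $ k))\<^sup>2) > 0"
    proof (rule prod_pos)
      fix k
      have "x \<noteq> a $ k" using a[of k] x by auto
      then show "(cmod (x - a $ k))\<^sup>2 > 0" by simp
    qed
    ultimately show "(1 - (cmod (a $ j))\<^sup>2) * (\<Prod>k\<in>UNIV - {j}. (cmod (x - a $ k))\<^sup>2) > 0" by simp
  qed auto
  then show "poly ?R x \<noteq> 0" using R xnz by simp
  have "cmod (poly ?R x) = r" using R x \<open>r > 0\<close> by (simp add: norm_mult norm_power)
  with R show "poly ?R x = x ^ (CARD('n) - 1) * of_real (cmod (poly ?R x))" by simp
qed

text \<open>
  The fibre of \<open>\<lambda>\<close> is the zero set of \<open>P - \<lambda> S\<close>, where \<open>P/S\<close> is the Blaschke product. As \<open>n\<close> zeros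
  exhaust the degree, this polynomial is a multiple of \<open>\<Prod>\<^sub>k (z - w\<^sub>k)\<close>. Replacing \<open>P\<close> by
  \<open>P - \<lambda> S\<close> does not change the Wronskian with \<open>S\<close>, from which residue-freeness can be read off.
\<close>

lemma residue_free_fibre:
  fixes a w :: "complex ^ 'n"
  assumes a: "\<And>j. a $ j \<in> ball 0 1" and w: "inj (($) w)" "\<And>k. cmod (w $ k) = 1"
    and fibre: "\<And>k. blaschke a (w $ k) = l" and l: "l \<noteq> 0"
  shows "residue_free (blaschke_wronskian a) w"
proof -
  let ?P = "blaschke_numer a" and ?S = "blaschke_denom a"
  define G where "G = ?P - smult l ?S"
  define N where "N = (\<Prod>k\<in>UNIV. [:- (w $ k), 1:])"
  have n: "CARD('n) > 0" by simp
  have G_zero: "poly G x = 0" if "cmod x = 1" "blaschke a x = l" for x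
    using that blaschke_denom_nonzero[OF a, of x] by (simp add: G_def blaschke_eq_ratio field_simps)
  have "poly G (a $ i) \<noteq> 0" for i
  proof -
    have "poly ?P (a $ i) = 0" by (auto simp: poly_blaschke_numer)
    moreover have "poly ?S (a $ i) \<noteq> 0"
      by (rule blaschke_denom_nonzero[OF a]) (use a[of i] in simp)
    ultimately show ?thesis using l by (simp add: G_def)
  qed
  then have "G \<noteq> 0" by auto
  have "degree ?P = CARD('n)" unfolding blaschke_numer_def by (subst degree_prod_eq_sum_degree) auto
  moreover have "degree ?S \<le> CARD('n)"
  proof -
    have "degree ?S \<le> (\<Sum>j\<in>(UNIV :: 'n set). degree [:1, - cnj (a $ j):])"
      unfolding blaschke_denom_def
      using degree_prod_sum_le[of UNIV "\<lambda>j. [:1, - cnj (a $ j):]"] by (simp add: o_def)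
    also have "\<dots> \<le> (\<Sum>j\<in>(UNIV :: 'n set). 1)"
      by (rule sum_mono) simp
    finally show ?thesis by simp
  qed
  ultimately have "degree G \<le> CARD('n)"
    unfolding G_def using degree_diff_le[of ?P "CARD('n)" "smult l ?S"] degree_smult_le[of l ?S] by simp
  moreover have degN: "degree N = CARD('n)"
    unfolding N_def by (subst degree_prod_eq_sum_degree) auto
  have "N dvd G" unfolding N_def
    by (rule prod_linear_factors_dvd) (use w in \<open>auto simp: G_zero fibre\<close>)
  then obtain E where E: "G = N * E" by (elim dvdE)
  have "E \<noteq> 0" using E \<open>G \<noteq> 0\<close> by auto
  moreover have "N \<noteq> 0" using E \<open>G \<noteq> 0\<close> by auto
  ultimately have "degree E = 0" using degN E by (simp add: degree_mult_eq)
  then obtain \<kappa> where "E = [:\<kappa>:]" by (rule degree_eq_zeroE)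
  with E have G: "G = smult \<kappa> N" by simp
  have "wronskian G ?S = wronskian ?P ?S"
    by (simp add: G_def wronskian_def pderiv_diff pderiv_smult algebra_simps)
  moreover have "wronskian G ?S = smult \<kappa> (wronskian N ?S)"
    by (simp add: G wronskian_def pderiv_smult smult_diff_right)
  ultimately have R: "wronskian ?P ?S = smult \<kappa> (wronskian N ?S)" by simp
  show "residue_free (wronskian ?P ?S) w"
    unfolding residue_free_def
  proof
    fix j
    let ?q = "punctured_poly w j"
    have N: "N = [:- (w $ j), 1:] * ?q"
      unfolding N_def punctured_poly_def by (subst prod.remove[of _ j]) auto
    have 0: "poly N (w $ j) = 0" by (simp add: N)
    have 1: "poly (pderiv N) (w $ j) = poly ?q (w $ j)"
      by (simp add: N pderiv_mult pderiv_pCons del: mult_pCons_left)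
    have 2: "poly (pderiv (pderiv N)) (w $ j) = 2 * poly (pderiv ?q) (w $ j)"
      by (simp add: N pderiv_mult pderiv_add pderiv_pCons del: mult_pCons_left)
    have "poly (wronskian ?P ?S) (w $ j) = \<kappa> * (poly ?q (w $ j) * poly ?S (w $ j))"
      unfolding R by (simp add: wronskian_def 0 1)
    moreover have "poly (pderiv (wronskian ?P ?S)) (w $ j) =
        \<kappa> * (2 * poly (pderiv ?q) (w $ j) * poly ?S (w $ j))"
      unfolding R by (simp add: pderiv_smult wronskian_def pderiv_diff pderiv_mult 0 1 2 algebra_simps)
    ultimately show "poly (pderiv (wronskian ?P ?S)) (w $ j) * poly ?q (w $ j) =
        2 * poly (wronskian ?P ?S) (w $ j) * poly (pderiv ?q) (w $ j)"
      by simp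
  qed
qed

section \<open>Critical points and the energy\<close>

lemma order_linear_factor: "Polynomial.order z [:- a, 1:] = (if z = a then 1 else 0)" for a :: complex
  using order_power_n_n[of a 1] by (auto intro: order_0I)

lemma prod_linear_factors_dvd_multiplicity:
  fixes p :: "complex poly"
  assumes "finite K" "p \<noteq> 0" "\<And>z. card {k \<in> K. \<zeta> k = z} \<le> Polynomial.order z p"
  shows "(\<Prod>k\<in>K. [:- \<zeta> k, 1:]) dvd p"
  using assms
proof (induction K arbitrary: p rule: finite_induct)
  case empty
  then show ?case by simp
next
  case (insert a K)
  have count: "card {k \<in> insert a K. \<zeta> k = z} = (if z = \<zeta> a then 1 else 0) + card {k \<in> K. \<zeta> k = z}" for z
  proof (cases "z = \<zeta> a")
    case True
    then have "{k \<in> insert a K. \<zeta> k = z} = insert a {k \<in> K. \<zeta> k = z}" by auto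
    then show ?thesis using True insert.hyps by simp
  next
    case False
    then have "{k \<in> insert a K. \<zeta> k = z} = {k \<in> K. \<zeta> k = z}" by auto
    then show ?thesis using False by simp
  qed
  have "Polynomial.order (\<zeta> a) p \<noteq> 0" using insert.prems(2)[of "\<zeta> a"] count[of "\<zeta> a"] by simp
  then have "poly p (\<zeta> a) = 0" using order_root by blast
  then obtain q where q: "p = [:- \<zeta> a, 1:] * q" by (metis poly_eq_0_iff_dvd dvdE)
  have "(\<Prod>k\<in>K. [:- \<zeta> k, 1:]) dvd q"
  proof (rule insert.IH)
    show "q \<noteq> 0" using q insert.prems(1) by auto
    show "card {k \<in> K. \<zeta> k = z} \<le> Polynomial.order z q" for z
    proof -
      have "Polynomial.order z p = (if z = \<zeta> a then 1 else 0) + Polynomial.order z q"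
        using insert.prems(1) unfolding q by (subst order_mult) (auto simp only: order_linear_factor)
      then show ?thesis using insert.prems(2)[of z] count[of z] by linarith
    qed
  qed
  then show ?case using insert.hyps by (simp add: q mult_dvd_mono del: mult_pCons_left)
qed

lemma prod_linear_factors_dvd_cancel:
  fixes p q :: "complex poly"
  assumes "finite K" "(\<Prod>k\<in>K. [:- \<zeta> k, 1:]) dvd p * q" "\<And>k. k \<in> K \<Longrightarrow> poly p (\<zeta> k) \<noteq> 0"
  shows "(\<Prod>k\<in>K. [:- \<zeta> k, 1:]) dvd q"
  using assms
proof (induction K arbitrary: q rule: finite_induct)
  case empty
  then show ?case by simp
next
  case (insert a K)
  let ?l = "[:- \<zeta> a, 1:]"
  have dvd: "?l * (\<Prod>k\<in>K. [:- \<zeta> k, 1:]) dvd p * q"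
    using insert.prems(1) insert.hyps by (simp del: mult_pCons_left)
  then have "poly (p * q) (\<zeta> a) = 0" by (metis dvd_mult_left poly_eq_0_iff_dvd)
  then have "poly q (\<zeta> a) = 0" using insert.prems(2)[of a] by simp
  then obtain q' where q': "q = ?l * q'" by (metis poly_eq_0_iff_dvd dvdE)
  have "?l * (\<Prod>k\<in>K. [:- \<zeta> k, 1:]) dvd ?l * (p * q')"
    using dvd unfolding q' by (simp only: mult.left_commute)
  then have "(\<Prod>k\<in>K. [:- \<zeta> k, 1:]) dvd p * q'" by (subst (asm) dvd_mult_cancel_left) auto
  then have "(\<Prod>k\<in>K. [:- \<zeta> k, 1:]) dvd q'" by (rule insert.IH) (use insert.prems in auto)
  then show ?case using insert.hyps by (simp add: q' mult_dvd_mono del: mult_pCons_left)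
qed

definition conj_reverse :: "nat \<Rightarrow> complex poly \<Rightarrow> complex poly" where
  "conj_reverse m p = (\<Sum>i\<le>m. monom (cnj (coeff p i)) (m - i))"

lemma poly_conj_reverse:
  assumes "degree p \<le> m" "cmod x = 1"
  shows "poly (conj_reverse m p) x = x ^ m * cnj (poly p x)"
proof -
  have x: "x * cnj x = 1" using assms(2) complex_norm_square[of x] by simp
  have "poly (conj_reverse m p) x = (\<Sum>i\<le>m. cnj (coeff p i) * x ^ (m - i))"
    by (simp add: conj_reverse_def poly_sum poly_monom)
  also have "\<dots> = (\<Sum>i\<le>m. x ^ m * (cnj (coeff p i) * cnj x ^ i))"
  proof (intro sum.cong refl)
    fix i assume "i \<in> {..m}"
    then have "x ^ m = x ^ (m - i) * x ^ i" by (simp add: power_add[symmetric])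
    moreover have "x ^ i * cnj x ^ i = 1" using x by (metis power_mult_distrib power_one)
    moreover have "c * Y = X * (c * Z)" if "X = Y * V" "V * Z = 1" for c X Y V Z :: complex
      using that by algebra
    ultimately show "cnj (coeff p i) * x ^ (m - i) = x ^ m * (cnj (coeff p i) * cnj x ^ i)" by metis
  qed
  also have "\<dots> = x ^ m * cnj (\<Sum>i\<le>m. coeff p i * x ^ i)"
    by (simp add: sum_distrib_left)
  also have "(\<Sum>i\<le>m. coeff p i * x ^ i) = poly p x"
    unfolding poly_altdef
    by (rule sum.mono_neutral_right) (use assms(1) in \<open>auto simp: coeff_eq_0\<close>)
  finally show ?thesis .
qed

lemma poly_eqI_unit_circle:
  fixes p q :: "complex poly"
  assumes "\<And>x. cmod x = 1 \<Longrightarrow> poly p x = poly q x"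
  shows "p = q"
proof (rule ccontr)
  assume "p \<noteq> q"
  then have "finite {x. poly (p - q) x = 0}" by (intro poly_roots_finite) simp
  moreover have "cis ` {0<..<1} \<subseteq> {x. poly (p - q) x = 0}" using assms by auto
  ultimately have "finite (cis ` {0<..<1})" by (rule rev_finite_subset)
  moreover have "inj_on cis {0<..<1}"
  proof (rule inj_onI)
    fix s t :: real assume st: "s \<in> {0<..<1}" "t \<in> {0<..<1}" "cis s = cis t"
    then have "cos s = cos t" by (metis cis.sel(1))
    then show "s = t" by (rule cos_inj_pi[rotated -1]) (use st pi_gt3 in auto)
  qed
  ultimately have "finite {0<..<1::real}" by (rule finite_imageD)
  then show False using infinite_Ioo[of 0 "1::real"] by simp
qed

text \<open>
  On the circle \<open>R\<close> agrees with its conjugate reversal of degree \<open>2n - 2\<close>. Hence its zeros come in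
  pairs of mirror points, and \<open>n - 1\<close> zeros in the disc with their mirror points account for the
  whole degree.
\<close>

lemma circle_positive_factorization:
  assumes R: "circle_positive n R" and K: "finite K" "card K = n - 1"
    and \<zeta>: "\<And>k. k \<in> K \<Longrightarrow> \<zeta> k \<in> ball 0 1 - {0}"
    and dvd: "(\<Prod>k\<in>K. [:- \<zeta> k, 1:]) dvd R"
  obtains c where "c > 0"
    "\<forall>x. cmod x = 1 \<longrightarrow> cmod (poly R x) = c * (\<Prod>k\<in>K. cmod ((x - \<zeta> k) * (x - reflect (\<zeta> k))))"
proof -
  let ?m = "n - 1"
  define Z where "Z = (\<Prod>k\<in>K. [:- \<zeta> k, 1:])"
  define Z' where "Z' = (\<Prod>k\<in>K. [:- reflect (\<zeta> k), 1:])"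
  define C where "C = (\<Prod>k\<in>K. - cnj (\<zeta> k))"
  obtain H where H: "R = Z * H" using dvd unfolding Z_def by (elim dvdE)
  have deg: "degree Z = ?m" "degree Z' = ?m"
    unfolding Z_def Z'_def using K by (simp_all add: degree_prod_eq_sum_degree)
  have "poly R 1 \<noteq> 0" using R by (simp add: circle_positive_def)
  then have "R \<noteq> 0" by auto
  then have "degree R = ?m + degree H" using H deg by (simp add: degree_mult_eq)
  then have degH: "degree H \<le> ?m" using R by (simp add: circle_positive_def)
  have "Z * H = smult C (Z' * conj_reverse ?m H)"
  proof (rule poly_eqI_unit_circle)
    fix x assume x: "cmod x = 1"
    have xx: "x * cnj x = 1" using x complex_norm_square[of x] by simp
    have Rx: "poly R x = x ^ ?m * of_real (cmod (poly R x))"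
      using R x by (auto simp: circle_positive_def)
    have "poly R x = x ^ ?m * (x ^ ?m * cnj (poly R x))"
    proof -
      have "x ^ ?m * cnj x ^ ?m = 1" using xx by (metis power_mult_distrib power_one)
      moreover have "cnj (poly R x) = cnj x ^ ?m * of_real (cmod (poly R x))"
        by (subst Rx) simp
      moreover have "p = X * (X * q)" if "X * Y = 1" "q = Y * r" "p = X * r" for X Y p q r :: complex
        using that by algebra
      ultimately show ?thesis using Rx by metis
    qed
    also have "\<dots> = (x ^ ?m * cnj (poly Z x)) * (x ^ ?m * cnj (poly H x))"
      by (simp add: H)
    also have "x ^ ?m * cnj (poly Z x) = (\<Prod>k\<in>K. x * cnj (x - \<zeta> k))"
      by (simp add: Z_def poly_prod K(2) prod.distrib)
    also have "\<dots> = (\<Prod>k\<in>K. - cnj (\<zeta> k) * (x - reflect (\<zeta> k)))"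
    proof (rule prod.cong[OF refl])
      fix k assume "k \<in> K"
      then have "\<zeta> k \<noteq> 0" using \<zeta> by auto
      then show "x * cnj (x - \<zeta> k) = - cnj (\<zeta> k) * (x - reflect (\<zeta> k))"
        using xx by (simp add: reflect_def algebra_simps)
    qed
    also have "\<dots> = C * poly Z' x" unfolding prod.distrib by (simp add: C_def Z'_def poly_prod)
    also have "x ^ ?m * cnj (poly H x) = poly (conj_reverse ?m H) x"
      by (rule poly_conj_reverse[OF degH x, symmetric])
    finally show "poly (Z * H) x = poly (smult C (Z' * conj_reverse ?m H)) x"
      by (simp add: H mult.assoc)
  qed
  then have "Z' dvd Z * H" by (metis dvd_smult dvd_triv_left)
  then have "Z' dvd H" unfolding Z'_def
  proof (rule prod_linear_factors_dvd_cancel[OF K(1)])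
    fix k assume k: "k \<in> K"
    have "cmod (reflect (\<zeta> k)) > 1"
      using \<zeta>[OF k] by (simp add: reflect_def norm_divide)
    then show "poly Z (reflect (\<zeta> k)) \<noteq> 0"
      using \<zeta> K(1) by (fastforce simp: Z_def poly_prod)
  qed
  then obtain E where E: "H = Z' * E" by (elim dvdE)
  have nz: "Z' \<noteq> 0" "E \<noteq> 0" using \<open>R \<noteq> 0\<close> H E by auto
  then have "degree E = 0" using degH E deg by (simp add: degree_mult_eq)
  then obtain e where "E = [:e:]" by (rule degree_eq_zeroE)
  with E H nz have R_eq: "R = smult e (Z * Z')" and "e \<noteq> 0" by auto
  have "cmod (poly R x) = cmod e * (\<Prod>k\<in>K. cmod ((x - \<zeta> k) * (x - reflect (\<zeta> k))))" for x
    by (simp add: R_eq norm_mult Z_def Z'_def poly_prod prod_norm prod.distrib)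
  with \<open>e \<noteq> 0\<close> show ?thesis by (intro that[of "cmod e"]) auto
qed

lemma zorder_deriv_blaschke:
  fixes a :: "complex ^ 'n"
  assumes a: "\<And>j. a $ j \<in> ball 0 1" and z: "cmod z < 1" and nz: "blaschke_wronskian a \<noteq> 0"
  shows "zorder (deriv (blaschke a)) z = int (Polynomial.order z (blaschke_wronskian a))"
proof -
  let ?R = "blaschke_wronskian a" and ?S = "blaschke_denom a"
  obtain Q where Q: "?R = [:- z, 1:] ^ Polynomial.order z ?R * Q" "\<not> [:- z, 1:] dvd Q"
    using order_decomp[OF nz] by blast
  have Sz: "poly ?S z \<noteq> 0" by (rule blaschke_denom_nonzero[OF a]) (use z in auto)
  have "open {u. poly ?S u \<noteq> 0}"
    by (intro open_Collect_neq continuous_intros)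
  then show ?thesis
  proof (rule zorder_eqI[where g = "\<lambda>u. poly Q u / (poly ?S u)\<^sup>2"])
    show "(\<lambda>u. poly Q u / (poly ?S u)\<^sup>2) holomorphic_on {u. poly ?S u \<noteq> 0}"
      by (intro holomorphic_intros) auto
    show "poly Q z / (poly ?S z)\<^sup>2 \<noteq> 0" using Sz Q(2) by (simp add: poly_eq_0_iff_dvd)
    fix w assume "w \<in> {u. poly ?S u \<noteq> 0}"
    then have "deriv (blaschke a) w = poly ?R w / (poly ?S w)\<^sup>2" by (simp add: deriv_blaschke)
    also have "poly ?R w = (w - z) ^ Polynomial.order z ?R * poly Q w"
      by (subst Q(1)) (simp add: poly_power)
    finally show "deriv (blaschke a) w = poly Q w / (poly ?S w)\<^sup>2 * (w - z) powi int (Polynomial.order z ?R)"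
      by simp
  qed (use Sz in simp)
qed

text \<open>
  The whole closed disc is free of poles of the Blaschke product, so that the multiplicities of the
  critical points in the disc are the multiplicities of the zeros of the Wronskian there. The zeros
  outside follow by reflection, including those that are poles of the Blaschke product.
\<close>

lemma critical_point_factorization:
  fixes a :: "complex ^ 'n"
  assumes a: "\<And>j. a $ j \<in> ball 0 1" and crit: "lists_critical_points a \<zeta>"
  obtains c where "c > 0"
    "\<forall>x. cmod x = 1 \<longrightarrow> cmod (poly (blaschke_wronskian a) x) =
       c * (\<Prod>k\<in>{1..<CARD('n)}. cmod ((x - \<zeta> k) * (x - reflect (\<zeta> k))))"
proof (rule circle_positive_factorization)
  let ?R = "blaschke_wronskian a" and ?K = "{1..<CARD('n)}"
  show pos: "circle_positive CARD('n) ?R" by (rule circle_positive_blaschke_wronskian[OF a])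
  show "finite ?K" "card ?K = CARD('n) - 1" by auto
  show \<zeta>: "\<zeta> k \<in> ball 0 1 - {0}" if "k \<in> ?K" for k
    using crit that by (auto simp: lists_critical_points_def)
  have "poly ?R 1 \<noteq> 0" using pos by (simp add: circle_positive_def)
  then have nz: "?R \<noteq> 0" by auto
  show "(\<Prod>k\<in>?K. [:- \<zeta> k, 1:]) dvd ?R"
  proof (rule prod_linear_factors_dvd_multiplicity)
    fix z
    show "card {k \<in> ?K. \<zeta> k = z} \<le> Polynomial.order z ?R"
    proof (cases "cmod z < 1")
      case True
      have "poly (blaschke_denom a) z \<noteq> 0"
        by (rule blaschke_denom_nonzero[OF a]) (use True in auto)
      then have "\<forall>j. 1 - cnj (a $ j) * z \<noteq> 0" by (auto simp: poly_blaschke_denom)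
      then have "zorder (deriv (blaschke a)) z =
          int (card {k\<in>?K. \<zeta> k = z} + card {k\<in>?K. reflect (\<zeta> k) = z})"
        using crit by (simp add: lists_critical_points_def)
      then show ?thesis
        using zorder_deriv_blaschke[OF a True nz] by linarith
    next
      case False
      then have "{k \<in> ?K. \<zeta> k = z} = {}" using \<zeta> by fastforce
      then show ?thesis by (simp only: card.empty)
    qed
  qed (use nz in auto)
qed (use that in auto)

lemma ln_separation:
  fixes w :: "complex ^ 'n"
  assumes w: "inj (($) w)"
  shows "ln (separation w) = (\<Sum>i\<in>UNIV. \<Sum>k\<in>UNIV - {i}. ln (cmod (w $ i - w $ k)))"
proof -
  have nz: "w $ i \<noteq> w $ k" if "k \<in> UNIV - {i}" for i k using injD[OF w, of i k] that by auto
  then have "ln (\<Prod>k\<in>UNIV - {i}. cmod (w $ i - w $ k)) = (\<Sum>k\<in>UNIV - {i}. ln (cmod (w $ i - w $ k)))" for i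
    by (intro ln_prod) auto
  moreover have "ln (separation w) = (\<Sum>i\<in>UNIV. ln (\<Prod>k\<in>UNIV - {i}. cmod (w $ i - w $ k)))"
    unfolding separation_def poly_punctured_poly prod_norm[symmetric]
    by (rule ln_prod) (use nz in auto)
  ultimately show ?thesis by simp
qed

text \<open>
  The product formula turns the interaction with the \<open>\<zeta>\<^sub>k\<close> and their mirror points into values of
  \<open>R\<close>. In the logarithm of \<^const>\<open>separation\<close> every unordered pair of points occurs twice, which is the
  factor \<open>2\<close> in the energy.
\<close>

lemma energy_eq_log_ratio:
  fixes w :: "complex ^ 'n::{finite,linorder}"
  assumes w: "inj (($) w)" "\<And>j. cmod (w $ j) = 1" and "c > 0"
    and R: "\<forall>x. cmod x = 1 \<longrightarrow> cmod (poly R x) =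
       c * (\<Prod>k\<in>{1..<CARD('n)}. cmod ((x - \<zeta> k) * (x - reflect (\<zeta> k))))"
    and nz: "\<And>x. cmod x = 1 \<Longrightarrow> poly R x \<noteq> 0"
  shows "energy \<zeta> w = ereal ((\<Sum>j\<in>UNIV. ln (cmod (poly R (w $ j)))) - ln (separation w) - real CARD('n) * ln c)"
proof -
  let ?K = "{1..<CARD('n)}"
  let ?g = "\<lambda>k x. cmod ((x - \<zeta> k) * (x - reflect (\<zeta> k)))"
  have ln_R: "ln (cmod (poly R x)) = ln c + (\<Sum>k\<in>?K. ln (?g k x))" if x: "cmod x = 1" for x
  proof -
    have "(\<Prod>k\<in>?K. ?g k x) \<noteq> 0" using nz[OF x] R[rule_format, OF x] by (metis mult_zero_right norm_eq_zero)
    then have "?g k x \<noteq> 0" if "k \<in> ?K" for k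
      using that by (metis finite_atLeastLessThan prod_zero_iff)
    then have "ln (\<Prod>k\<in>?K. ?g k x) = (\<Sum>k\<in>?K. ln (?g k x))"
      by (intro ln_prod) auto
    then show ?thesis
      unfolding R[rule_format, OF x] using \<open>c > 0\<close> \<open>(\<Prod>k\<in>?K. ?g k x) \<noteq> 0\<close>
      by (simp only: ln_mult) simp
  qed
  have "(\<Sum>k\<in>?K. \<Sum>j\<in>UNIV. ln (?g k (w $ j))) = (\<Sum>j\<in>UNIV. \<Sum>k\<in>?K. ln (?g k (w $ j)))"
    by (rule sum.swap)
  also have "\<dots> = (\<Sum>j\<in>UNIV. ln (cmod (poly R (w $ j)))) - real CARD('n) * ln c"
    by (simp add: ln_R[OF w(2)] sum.distrib)
  finally have first: "(\<Sum>k\<in>?K. \<Sum>j\<in>UNIV. ln (?g k (w $ j))) = \<dots>" .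
  let ?d = "\<lambda>j k. ln (cmod (w $ j - w $ k))"
  have "ln (separation w) = (\<Sum>i\<in>UNIV. \<Sum>k\<in>UNIV - {i}. ?d i k)"
    by (rule ln_separation[OF w(1)])
  also have "\<dots> = (\<Sum>(i, k)\<in>(SIGMA i:UNIV. UNIV - {i}). ?d i k)"
    by (rule sum.Sigma) auto
  also have "(SIGMA i:(UNIV :: 'n set). UNIV - {i}) = {(i, k). i < k} \<union> {(i, k). k < i}"
    by auto
  also have "(\<Sum>(i, k)\<in>{(i, k). i < k} \<union> {(i, k). k < i}. ?d i k) =
      (\<Sum>(i, k)\<in>{(i, k). i < k}. ?d i k) + (\<Sum>(i, k)\<in>{(i, k). k < i}. ?d i k)"
    by (rule sum.union_disjoint) (auto intro: finite_subset[OF subset_UNIV])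
  also have "(\<Sum>(i, k)\<in>{(i, k). k < i}. ?d i k) = (\<Sum>(i, k)\<in>{(i, k). i < k}. ?d i k)"
    by (rule sum.reindex_bij_witness[of _ prod.swap prod.swap]) (auto simp: norm_minus_commute)
  finally have second: "ln (separation w) = 2 * (\<Sum>(i, k)\<in>{(i, k). i < k}. ?d i k)" by simp
  have "\<not> (\<exists>j k. j \<noteq> k \<and> w $ j = w $ k)" using injD[OF w(1)] by blast
  then show ?thesis unfolding energy_def first second by simp
qed

section \<open>Stationary points of the energy\<close>

definition circle_points :: "real ^ 'n \<Rightarrow> complex ^ 'n" where
  "circle_points \<tau> = (\<chi> j. cis (\<tau> $ j))"

definition log_ratio :: "complex poly \<Rightarrow> complex ^ 'n \<Rightarrow> real" where
  "log_ratio R w = (\<Sum>j\<in>UNIV. ln (cmod (poly R (w $ j)))) - ln (separation w)"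

lemma circle_points_nth [simp]: "circle_points \<tau> $ j = cis (\<tau> $ j)"
  by (simp add: circle_points_def)

lemma angular_energy_eq_log_ratio:
  fixes \<tau> :: "real ^ 'n::{finite,linorder}"
  assumes R: "circle_positive CARD('n) R" and "c > 0"
    and fact: "\<forall>x. cmod x = 1 \<longrightarrow> cmod (poly R x) =
       c * (\<Prod>k\<in>{1..<CARD('n)}. cmod ((x - \<zeta> k) * (x - reflect (\<zeta> k))))"
    and inj: "inj (($) (circle_points \<tau>))"
  shows "angular_energy \<zeta> \<tau> = ereal (log_ratio R (circle_points \<tau>) - real CARD('n) * ln c)"
proof -
  have "energy \<zeta> (circle_points \<tau>) = ereal (log_ratio R (circle_points \<tau>) - real CARD('n) * ln c)"
    unfolding log_ratio_def
    by (rule energy_eq_log_ratio[OF inj _ \<open>c > 0\<close> fact])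
      (use R in \<open>auto simp: circle_positive_def\<close>)
  then show ?thesis by (simp only: angular_energy_def circle_points_def)
qed

lemma log_ratio_le_iff:
  fixes x w :: "complex ^ 'n"
  assumes w: "inj (($) w)" "\<And>k. cmod (w $ k) = 1" and x: "inj (($) x)" "\<And>k. cmod (x $ k) = 1"
    and R: "circle_positive CARD('n) R"
  shows "log_ratio R w \<le> log_ratio R x \<longleftrightarrow>
    (\<Prod>i\<in>UNIV. cmod (poly R (w $ i))) * separation x \<le> (\<Prod>i\<in>UNIV. cmod (poly R (x $ i))) * separation w"
proof -
  have pos: "(\<Prod>i\<in>UNIV. cmod (poly R (y $ i))) > 0 \<and>
      log_ratio R y = ln (\<Prod>i\<in>UNIV. cmod (poly R (y $ i))) - ln (separation y)"
    if "\<And>k. cmod (y $ k) = 1" for y :: "complex ^ 'n"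
  proof -
    have "poly R (y $ i) \<noteq> 0" for i using R that by (auto simp: circle_positive_def)
    then show ?thesis unfolding log_ratio_def by (subst ln_prod) (auto intro: prod_pos)
  qed
  have "ln a - ln s \<le> ln b - ln t \<longleftrightarrow> a * t \<le> b * s"
    if "a > 0" "b > 0" "s > 0" "t > 0" for a b s t :: real
    using that ln_le_cancel_iff[of "a * t" "b * s"] by (simp add: ln_mult) linarith
  then show ?thesis
    using pos[OF w(2)] pos[OF x(2)] separation_pos[OF w(1)] separation_pos[OF x(1)] by simp
qed

lemma inj_circle_points_iff:
  "inj (($) (circle_points \<tau>)) \<longleftrightarrow> (\<forall>i j. i \<noteq> j \<longrightarrow> cis (\<tau> $ i) \<noteq> cis (\<tau> $ j))"
  by (auto simp: inj_def)

lemma open_inj_circle_points: "open {\<tau> :: real ^ 'n. inj (($) (circle_points \<tau>))}"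
proof -
  have "{\<tau> :: real ^ 'n. inj (($) (circle_points \<tau>))} =
      (\<Inter>p\<in>{p. fst p \<noteq> snd p}. {\<tau>. cis (\<tau> $ fst p) \<noteq> cis (\<tau> $ snd p)})"
    unfolding inj_circle_points_iff by auto
  moreover have "open {\<tau> :: real ^ 'n. cis (\<tau> $ i) \<noteq> cis (\<tau> $ k)}" for i k
    by (intro open_Collect_neq continuous_intros)
  ultimately show ?thesis by (simp add: open_INT)
qed

lemma differentiable_ln_norm:
  fixes f :: "'a::real_normed_vector \<Rightarrow> complex"
  assumes "f differentiable (at x)" and "f x \<noteq> 0"
  shows "(\<lambda>x. ln (cmod (f x))) differentiable (at x)"
proof (rule differentiable_compose[where f = ln])
  show "(\<lambda>x. cmod (f x)) differentiable (at x)"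
    by (rule differentiable_compose[where f = cmod]) (use assms in auto)
  have "cmod (f x) > 0" using assms(2) by simp
  from DERIV_ln[OF this] have "ln field_differentiable (at (cmod (f x)))"
    unfolding field_differentiable_def by blast
  then show "ln differentiable (at (cmod (f x)))"
    by (rule field_differentiable_imp_differentiable)
qed

lemma differentiable_log_ratio_circle_points:
  fixes \<tau> :: "real ^ 'n"
  assumes R: "circle_positive CARD('n) R" and inj: "inj (($) (circle_points \<tau>))"
  shows "(\<lambda>\<sigma>. log_ratio R (circle_points \<sigma>)) differentiable (at \<tau>)"
proof -
  define \<Phi> where "\<Phi> \<sigma> = (\<Sum>j\<in>UNIV. ln (cmod (poly R (cis (\<sigma> $ j))))) -
      (\<Sum>i\<in>UNIV. \<Sum>k\<in>UNIV - {i}. ln (cmod (cis (\<sigma> $ i) - cis (\<sigma> $ k))))" for \<sigma> :: "real ^ 'n"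
  have nth: "(\<lambda>\<sigma> :: real ^ 'n. \<sigma> $ j) differentiable (at \<tau>)" for j
    using bounded_linear_imp_differentiable[OF bounded_linear_vec_nth] .
  have cis: "(\<lambda>\<sigma> :: real ^ 'n. cis (\<sigma> $ j)) differentiable (at \<tau>)" for j
    using nth[of j] has_derivative_cis unfolding differentiable_def by blast
  have "(\<lambda>\<sigma>. poly R (cis (\<sigma> $ j))) differentiable (at \<tau>)" for j
  proof (rule differentiable_compose[where f = "poly R", OF _ cis])
    show "poly R differentiable (at (cis (\<tau> $ j)))"
      using poly_DERIV field_differentiable_def field_differentiable_imp_differentiable by blast
  qed
  moreover have "poly R (cis (\<tau> $ j)) \<noteq> 0" for j
    using R by (simp add: circle_positive_def)
  ultimately have 1: "(\<lambda>\<sigma>. ln (cmod (poly R (cis (\<sigma> $ j))))) differentiable (at \<tau>)" for j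
    by (rule differentiable_ln_norm)
  have 2: "(\<lambda>\<sigma>. ln (cmod (cis (\<sigma> $ i) - cis (\<sigma> $ k)))) differentiable (at \<tau>)" if "i \<noteq> k" for i k
    using that inj by (intro differentiable_ln_norm differentiable_diff cis) (auto simp: inj_circle_points_iff)
  have "\<Phi> differentiable (at \<tau>)"
    unfolding \<Phi>_def using 1 2 by (intro differentiable_diff differentiable_sum ballI) auto
  then obtain D where "(\<Phi> has_derivative D) (at \<tau>)" by (auto simp: differentiable_def)
  then have "((\<lambda>\<sigma>. log_ratio R (circle_points \<sigma>)) has_derivative D) (at \<tau>)"
    by (rule has_derivative_transform_within_open[OF _ open_inj_circle_points])
      (use inj in \<open>auto simp: \<Phi>_def log_ratio_def ln_separation\<close>)
  then show ?thesis by (auto simp: differentiable_def)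
qed

text \<open>
  Where two points collide, the real-valued version of the infinite energy is \<open>0\<close> and may lie below the
  minimum; Fermat's criterion is applied on the open set of distinct points.
\<close>

lemma minimum_gradient_vanishes:
  fixes \<tau> :: "real ^ 'n::{finite,linorder}"
  assumes R: "circle_positive CARD('n) R" and "c > 0"
    and fact: "\<forall>x. cmod x = 1 \<longrightarrow> cmod (poly R x) =
       c * (\<Prod>k\<in>{1..<CARD('n)}. cmod ((x - \<zeta> k) * (x - reflect (\<zeta> k))))"
    and inj: "inj (($) (circle_points \<tau>))"
    and min: "\<And>\<sigma> :: real ^ 'n::{finite,linorder}. inj (($) (circle_points \<sigma>)) \<Longrightarrow> log_ratio R (circle_points \<tau>) \<le> log_ratio R (circle_points \<sigma>)"
  shows "gradient_vanishes \<zeta> \<tau>"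
proof -
  let ?f = "\<lambda>\<sigma>. log_ratio R (circle_points \<sigma>) - real CARD('n) * ln c"
  have "?f differentiable (at \<tau>)"
    using differentiable_log_ratio_circle_points[OF R inj] by simp
  then obtain D where D: "(?f has_derivative D) (at \<tau>)" by (auto simp: differentiable_def)
  have "D = (\<lambda>v. 0)"
    by (rule differential_zero_maxmin[OF _ open_inj_circle_points D]) (use inj min in \<open>auto intro!: disjI2 ballI\<close>)
  with D have "(?f has_derivative (\<lambda>v. 0)) (at \<tau>)" by simp
  then have "((\<lambda>\<sigma>. real_of_ereal (angular_energy \<zeta> \<sigma>)) has_derivative (\<lambda>v. 0)) (at \<tau>)"
    by (rule has_derivative_transform_within_open[OF _ open_inj_circle_points])
      (use inj in \<open>auto simp: angular_energy_eq_log_ratio[OF R \<open>c > 0\<close> fact]\<close>)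
  then show ?thesis by (simp add: gradient_vanishes_def gderiv_def)
qed

lemma has_vector_derivative_poly_cis:
  "((\<lambda>t. poly p (cis t)) has_vector_derivative (\<i> * cis t * poly (pderiv p) (cis t))) (at t)"
proof -
  have "(cis has_vector_derivative (\<i> * cis t)) (at t)"
    using has_derivative_cis[OF has_derivative_ident, of t UNIV]
    by (simp add: has_vector_derivative_def)
  from field_vector_diff_chain_at[OF this poly_DERIV] show ?thesis by (simp add: o_def)
qed

lemma inj_replace_entry:
  fixes w :: "complex ^ 'n"
  assumes "inj (($) w)" "poly (punctured_poly w j) x \<noteq> 0"
  shows "inj (($) (replace_entry w j x))"
  using assms by (auto simp: inj_def replace_entry_def punctured_poly_eq_0_iff)

lemma log_ratio_replace_entry:
  fixes w :: "complex ^ 'n"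
  assumes w: "inj (($) w)" and x: "poly (punctured_poly w j) x \<noteq> 0"
  shows "log_ratio R (replace_entry w j x) =
    ln (cmod (poly R x)) - 2 * ln (cmod (poly (punctured_poly w j) x)) +
    ((\<Sum>k\<in>UNIV - {j}. ln (cmod (poly R (w $ k)))) - ln (separation w) +
     2 * ln (cmod (poly (punctured_poly w j) (w $ j))))"
proof -
  let ?q = "punctured_poly w j"
  have "ln (separation (replace_entry w j x) * (cmod (poly ?q (w $ j)))\<^sup>2) =
        ln (separation w * (cmod (poly ?q x))\<^sup>2)"
    by (simp only: separation_replace_entry)
  then have "ln (separation (replace_entry w j x)) + 2 * ln (cmod (poly ?q (w $ j))) =
        ln (separation w) + 2 * ln (cmod (poly ?q x))"
    using separation_pos[OF w] separation_pos[OF inj_replace_entry[OF w x]] punctured_poly_own_node[OF w, of j] x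
    by (simp add: ln_mult ln_realpow)
  moreover have "(\<Sum>k\<in>UNIV. ln (cmod (poly R (replace_entry w j x $ k)))) =
      ln (cmod (poly R x)) + (\<Sum>k\<in>UNIV - {j}. ln (cmod (poly R (w $ k))))"
    by (subst sum.remove[of _ j]) (auto simp: replace_entry_def)
  ultimately show ?thesis by (simp add: log_ratio_def)
qed

text \<open>
  Let \<open>q\<^sub>j\<close> be the monic polynomial whose zeros are the points other than the one with index \<open>j\<close>. As a
  function of the angle \<open>t\<close> of the latter, the energy is a constant plus the logarithm of
  \<open>|R(e\<^sup>i\<^sup>t) / q\<^sub>j(e\<^sup>i\<^sup>t)\<^sup>2|\<close>. The phase of this quotient is constant on the circle, so that the
  complex derivative of \<open>R / q\<^sub>j\<^sup>2\<close> vanishes as soon as the real partial derivative does.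
\<close>

lemma gradient_vanishes_residue_free:
  fixes \<tau> :: "real ^ 'n::{finite,linorder}"
  assumes R: "circle_positive CARD('n) R" and "c > 0"
    and fact: "\<forall>x. cmod x = 1 \<longrightarrow> cmod (poly R x) =
       c * (\<Prod>k\<in>{1..<CARD('n)}. cmod ((x - \<zeta> k) * (x - reflect (\<zeta> k))))"
    and inj: "inj (($) (circle_points \<tau>))" and grad: "gradient_vanishes \<zeta> \<tau>"
  shows "residue_free R (circle_points \<tau>)"
  unfolding residue_free_def
proof
  fix j
  let ?w = "circle_points \<tau>" and ?n = "CARD('n) - 1"
  let ?q = "punctured_poly ?w j"
  \<comment> \<open>\<open>h\<close> is the energy as a function of the angle with index \<open>j\<close>, on the set \<open>U\<close> where the points stay
    distinct; \<open>u\<close> is the constant part of the phase of \<open>?q\<^sup>2\<close> and \<open>v\<close> the constant factor in \<open>R = v e\<^sup>h ?q\<^sup>2\<close>.\<close>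
  define U where "U = {t. poly ?q (cis t) \<noteq> 0}"
  define \<sigma> where "\<sigma> t = \<tau> + (t - \<tau> $ j) *\<^sub>R axis j 1" for t
  define K where "K = (\<Sum>k\<in>UNIV - {j}. ln (cmod (poly R (?w $ k)))) - ln (separation ?w) +
     2 * ln (cmod (poly ?q (?w $ j))) - real CARD('n) * ln c"
  define h where "h t = ln (cmod (poly R (cis t))) - 2 * ln (cmod (poly ?q (cis t))) + K" for t
  define u where "u = (\<Prod>k\<in>UNIV - {j}. - (?w $ k))"
  define v where "v = of_real (exp (- K)) / u"
  have w1: "cmod (?w $ k) = 1" for k by simp
  have qw: "poly ?q (cis (\<tau> $ j)) \<noteq> 0" using punctured_poly_own_node[OF inj, of j] by simp
  then have \<tau>U: "\<tau> $ j \<in> U" by (simp add: U_def)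
  have openU: "open U" unfolding U_def by (intro open_Collect_neq continuous_intros)
  have \<sigma>\<tau>: "\<sigma> (\<tau> $ j) = \<tau>" by (simp add: \<sigma>_def)
  have points: "circle_points (\<sigma> t) = replace_entry ?w j (cis t)" for t
    by (simp add: vec_eq_iff \<sigma>_def replace_entry_def axis_def)
  have energy: "real_of_ereal (angular_energy \<zeta> (\<sigma> t)) = h t" if "t \<in> U" for t
  proof -
    have q: "poly ?q (cis t) \<noteq> 0" using that by (simp add: U_def)
    have "inj (($) (circle_points (\<sigma> t)))" unfolding points by (rule inj_replace_entry[OF inj q])
    from angular_energy_eq_log_ratio[OF R \<open>c > 0\<close> fact this]
    show ?thesis unfolding points log_ratio_replace_entry[OF inj q] by (simp add: h_def K_def)
  qed
  have "(h has_field_derivative 0) (at (\<tau> $ j))"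
  proof -
    have "(\<sigma> has_derivative (\<lambda>s. s *\<^sub>R axis j 1)) (at (\<tau> $ j))"
      unfolding \<sigma>_def by (auto intro!: derivative_eq_intros)
    moreover have "((\<lambda>\<sigma>. real_of_ereal (angular_energy \<zeta> \<sigma>)) has_derivative (\<lambda>v. 0)) (at (\<sigma> (\<tau> $ j)))"
      using grad by (simp add: gradient_vanishes_def gderiv_def \<sigma>\<tau>)
    ultimately have "((\<lambda>t. real_of_ereal (angular_energy \<zeta> (\<sigma> t))) has_derivative (\<lambda>s. 0)) (at (\<tau> $ j))"
      by (rule has_derivative_compose)
    then have "(h has_derivative (\<lambda>s. 0)) (at (\<tau> $ j))"
      by (rule has_derivative_transform_within_open[OF _ openU \<tau>U]) (rule energy)
    then show ?thesis by (rule has_derivative_imp_has_field_derivative) simp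
  qed
  then have "((\<lambda>t. exp (h t)) has_field_derivative 0) (at (\<tau> $ j))"
    using DERIV_fun_exp by fastforce
  then have "((\<lambda>t. v * of_real (exp (h t))) has_vector_derivative 0) (at (\<tau> $ j))"
    using has_vector_derivative_mult_right[OF has_vector_derivative_of_real, of "\<lambda>t. exp (h t)" 0 _ v]
    by (simp add: has_real_derivative_iff_has_vector_derivative)
  from has_vector_derivative_mult[OF this has_vector_derivative_poly_cis[of "?q\<^sup>2"]]
  have right: "((\<lambda>t. v * of_real (exp (h t)) * poly (?q\<^sup>2) (cis t)) has_vector_derivative
      v * of_real (exp (h (\<tau> $ j))) * (\<i> * cis (\<tau> $ j) * poly (pderiv (?q\<^sup>2)) (cis (\<tau> $ j)))) (at (\<tau> $ j))"
    by simp
  have quotient: "poly R (cis t) = v * of_real (exp (h t)) * poly (?q\<^sup>2) (cis t)" if "t \<in> U" for t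
  proof -
    have q: "poly ?q (cis t) \<noteq> 0" using that by (simp add: U_def)
    have nz: "poly R (cis t) \<noteq> 0" and Rt: "poly R (cis t) = cis t ^ ?n * of_real (cmod (poly R (cis t)))"
      using R by (auto simp: circle_positive_def)
    have "u \<noteq> 0" by (simp add: u_def)
    have sq: "(poly ?q (cis t))\<^sup>2 = cis t ^ ?n * u * of_real ((cmod (poly ?q (cis t)))\<^sup>2)"
      unfolding u_def by (rule punctured_poly_squared[OF _ w1]) simp
    have "exp (h t) * (cmod (poly ?q (cis t)))\<^sup>2 = exp K * cmod (poly R (cis t))"
      using nz q by (simp add: h_def exp_add exp_diff exp_double)
    then have exp: "exp (- K) * (exp (h t) * (cmod (poly ?q (cis t)))\<^sup>2) = cmod (poly R (cis t))"
      by (simp add: exp_minus)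
    have "v * of_real (exp (h t)) * (poly ?q (cis t))\<^sup>2 =
        cis t ^ ?n * of_real (exp (- K) * (exp (h t) * (cmod (poly ?q (cis t)))\<^sup>2))"
      unfolding sq v_def using \<open>u \<noteq> 0\<close> by (simp add: field_simps)
    then have "v * of_real (exp (h t)) * (poly ?q (cis t))\<^sup>2 = cis t ^ ?n * of_real (cmod (poly R (cis t)))"
      by (simp only: exp)
    then show ?thesis using Rt by (simp add: poly_power)
  qed
  have "((\<lambda>t. poly R (cis t)) has_vector_derivative
      v * of_real (exp (h (\<tau> $ j))) * (\<i> * cis (\<tau> $ j) * poly (pderiv (?q\<^sup>2)) (cis (\<tau> $ j)))) (at (\<tau> $ j))"
    by (rule has_vector_derivative_transform_within_open[OF right openU \<tau>U]) (simp add: quotient)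
  then have "\<i> * cis (\<tau> $ j) * poly (pderiv R) (cis (\<tau> $ j)) =
      v * of_real (exp (h (\<tau> $ j))) * (\<i> * cis (\<tau> $ j) * poly (pderiv (?q\<^sup>2)) (cis (\<tau> $ j)))"
    using has_vector_derivative_poly_cis vector_derivative_unique_at by blast
  then have "poly (pderiv R) (cis (\<tau> $ j)) = v * of_real (exp (h (\<tau> $ j))) * poly (pderiv (?q\<^sup>2)) (cis (\<tau> $ j))"
    by simp
  then show "poly (pderiv R) (?w $ j) * poly ?q (?w $ j) = 2 * poly R (?w $ j) * poly (pderiv ?q) (?w $ j)"
    using quotient[OF \<tau>U] by (simp add: power2_eq_square pderiv_mult)
qed

section \<open>The solution curve\<close>

lemma cis_eq_imp_int:
  assumes "cis s = cis t"
  obtains n :: int where "s - t = of_int n * (2 * pi)"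
proof -
  have "cis (s - t) = 1" using assms by (simp add: cis_divide[symmetric])
  then have "cos (s - t) = 1" by (metis cis.sel(1) one_complex.sel(1))
  then show ?thesis using that by (auto simp: cos_one_2pi_int)
qed

lemma cis_eq_imp_eq:
  assumes "cis s = cis t" "\<bar>s - t\<bar> < 2 * pi"
  shows "s = t"
proof -
  obtain n :: int where n: "s - t = of_int n * (2 * pi)" using cis_eq_imp_int[OF assms(1)] .
  then have "\<bar>of_int n :: real\<bar> < 1" using assms(2) by (simp add: abs_mult)
  then have "n = 0" by linarith
  with n show ?thesis by simp
qed

lemma prod_cis: "(\<Prod>j\<in>A. cis (f j)) = cis (\<Sum>j\<in>A. f j)"
  by (induction A rule: infinite_finite_induct) (simp_all add: cis_mult)

text \<open>
  A continuous argument of \<open>t \<mapsto> B(e\<^sup>i\<^sup>t)\<close>: the factor \<open>(e\<^sup>i\<^sup>t - a) / (1 - cnj a e\<^sup>i\<^sup>t)\<close> equals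
  \<open>e\<^sup>i\<^sup>t z / cnj z\<close> with \<open>z = 1 - a e\<^sup>-\<^sup>i\<^sup>t\<close>, and \<open>z\<close> stays in the right half plane, where the
  principal argument is continuous.
\<close>

definition blaschke_angle :: "complex ^ 'n \<Rightarrow> real \<Rightarrow> real" where
  "blaschke_angle a t = (\<Sum>j\<in>UNIV. t + 2 * Arg (1 - a $ j * cis (- t)))"

lemma Re_one_minus_pos:
  assumes "cmod b < 1"
  shows "Re (1 - b * cis s) > 0"
proof -
  have "Re (b * cis s) \<le> cmod (b * cis s)" by (rule complex_Re_le_cmod)
  also have "\<dots> < 1" using assms by (simp add: norm_mult)
  finally show ?thesis by simp
qed

lemma blaschke_cis:
  fixes a :: "complex ^ 'n"
  assumes a: "\<And>j. a $ j \<in> ball 0 1"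
  shows "blaschke a (cis t) = cis (blaschke_angle a t)"
proof -
  have "(cis t - a $ j) / (1 - cnj (a $ j) * cis t) = cis (t + 2 * Arg (1 - a $ j * cis (- t)))" for j
  proof -
    define z where "z = 1 - a $ j * cis (- t)"
    have "Re z > 0" unfolding z_def by (rule Re_one_minus_pos) (use a[of j] in simp)
    then have z: "z \<noteq> 0" by auto
    have "cis (2 * Arg z) = (cis (Arg z))\<^sup>2" by (simp add: power2_eq_square cis_mult)
    also have "\<dots> = z\<^sup>2 / of_real ((cmod z)\<^sup>2)" by (simp add: cis_Arg[OF z] sgn_eq power_divide)
    also have "\<dots> = z / cnj z"
      using z by (subst complex_norm_square) (simp add: power2_eq_square)
    finally have "cis (2 * Arg z) = z / cnj z" .
    moreover have "cis t * z = cis t - a $ j" by (simp add: z_def algebra_simps cis_mult)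
    moreover have "cnj z = 1 - cnj (a $ j) * cis t" by (simp add: z_def cis_cnj)
    ultimately show ?thesis unfolding z_def[symmetric] by (metis cis_mult times_divide_eq_right)
  qed
  then show ?thesis by (simp add: blaschke_def blaschke_angle_def prod_cis)
qed

lemma continuous_on_blaschke_angle:
  fixes a :: "complex ^ 'n"
  assumes a: "\<And>j. a $ j \<in> ball 0 1"
  shows "continuous_on UNIV (blaschke_angle a)"
  unfolding blaschke_angle_def
proof (intro continuous_intros)
  fix j t
  have "Re (1 - a $ j * cis (- t)) > 0" by (rule Re_one_minus_pos) (use a[of j] in simp)
  then show "1 - a $ j * cis (- t) \<notin> \<real>\<^sub>\<le>\<^sub>0" by (auto simp: complex_nonpos_Reals_iff)
qed

lemma blaschke_angle_period:
  fixes a :: "complex ^ 'n"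
  shows "blaschke_angle a (t + 2 * pi) = blaschke_angle a t + 2 * real CARD('n) * pi"
proof -
  have "cis (- (t + 2 * pi)) = cis (- t)" by (simp add: complex_eq_iff cos_diff sin_diff)
  then show ?thesis unfolding blaschke_angle_def by (simp add: sum.distrib algebra_simps)
qed

lemma blaschke_angle_bound:
  fixes a :: "complex ^ 'n"
  shows "\<bar>blaschke_angle a t - real CARD('n) * t\<bar> \<le> 2 * real CARD('n) * pi"
proof -
  have "blaschke_angle a t - real CARD('n) * t = (\<Sum>j\<in>UNIV. 2 * Arg (1 - a $ j * cis (- t)))"
    by (simp add: blaschke_angle_def sum.distrib)
  also have "\<bar>\<dots>\<bar> \<le> (\<Sum>j\<in>(UNIV :: 'n set). 2 * pi)"
  proof (rule sum_abs[THEN order_trans], rule sum_mono)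
    fix j
    show "\<bar>2 * Arg (1 - a $ j * cis (- t))\<bar> \<le> 2 * pi"
      using mpi_less_Arg[of "1 - a $ j * cis (- t)"] Arg_le_pi[of "1 - a $ j * cis (- t)"] by (simp add: abs_mult)
  qed
  finally show ?thesis by simp
qed

context
  fixes a :: "complex ^ 'n::{finite,linorder}" and \<alpha> :: real and T :: "real \<Rightarrow> real ^ 'n::{finite,linorder}"
  assumes a: "\<And>j. a $ j \<in> ball 0 1" and curve: "solution_curve a \<alpha> T"
begin

lemma continuous_on_curve: "continuous_on UNIV (\<lambda>\<delta>. T \<delta> $ j)"
  using curve C1_diff_imp_diff differentiable_imp_continuous_on unfolding solution_curve_def by blast

lemma blaschke_angle_curve:
  obtains k where "\<And>\<delta>. blaschke_angle a (T \<delta> $ j) = \<delta> + k"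
proof -
  define g where "g \<delta> = blaschke_angle a (T \<delta> $ j) - \<delta>" for \<delta>
  have "continuous_on UNIV g"
    unfolding g_def
    by (intro continuous_intros continuous_on_compose2[OF continuous_on_blaschke_angle[OF a] continuous_on_curve]) auto
  moreover have "\<exists>e>0. \<forall>y. y \<in> UNIV \<and> g y \<noteq> g x \<longrightarrow> e \<le> norm (g y - g x)" for x
  proof (intro exI[of _ "2 * pi"] conjI allI impI)
    fix y assume y: "y \<in> UNIV \<and> g y \<noteq> g x"
    \<comment> \<open>All values of \<open>g\<close> are multiples of \<open>2 \<pi>\<close>.\<close>
    have "cis (g d) = 1" for d
      using curve blaschke_cis[OF a, of "T d $ j"]
      by (simp add: g_def solution_curve_def cis_divide[symmetric])
    then have "cis (g y) = cis (g x)" by simp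
    then show "2 * pi \<le> norm (g y - g x)" using y cis_eq_imp_eq by force
  qed simp
  ultimately have "g constant_on UNIV"
    by (intro continuous_discrete_range_constant) auto
  then obtain k where "\<And>\<delta>. g \<delta> = k" by (auto simp: constant_on_def)
  then show ?thesis using that[of k] by (simp add: g_def algebra_simps)
qed

text \<open>
  The continuous argument of \<open>B\<close> differs from \<open>n t\<close> by at most \<open>2 n \<pi>\<close>, which makes the coordinates
  of the curve unbounded in both directions.
\<close>

lemma curve_surj: "\<exists>\<delta>. T \<delta> $ j = s"
proof -
  obtain k where k: "\<And>\<delta>. blaschke_angle a (T \<delta> $ j) = \<delta> + k" using blaschke_angle_curve[of j] by metis
  let ?n = "real CARD('n)"
  have n: "?n > 0" by simp
  have bound: "\<bar>\<delta> + k - ?n * T \<delta> $ j\<bar> \<le> 2 * ?n * pi" for \<delta>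
    using blaschke_angle_bound[of a "T \<delta> $ j"] by (simp add: k)
  define d where "d = ?n * s - k - 2 * ?n * pi"
  define d' where "d' = ?n * s - k + 2 * ?n * pi"
  have "d + k = ?n * s - 2 * ?n * pi" by (simp add: d_def)
  then have "?n * T d $ j \<le> ?n * s" using bound[of d] by linarith
  then have "T d $ j \<le> s" using n by simp
  moreover have "d' + k = ?n * s + 2 * ?n * pi" by (simp add: d'_def)
  then have "?n * s \<le> ?n * T d' $ j" using bound[of d'] by linarith
  then have "s \<le> T d' $ j" using n by simp
  moreover have "d \<le> d'" by (simp add: d_def d'_def)
  ultimately show ?thesis
    using IVT'[of "\<lambda>\<delta>. T \<delta> $ j" d s d'] continuous_on_subset[OF continuous_on_curve] by blast
qed

text \<open>
  Along the curve the continuous argument of \<open>B\<close> is \<open>\<delta>\<close> plus a constant. As each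
  coordinate of the curve covers the whole line, the continuous argument is injective, and its
  quasi-periodicity in the angle becomes that of the curve in \<open>\<delta>\<close>.
\<close>

lemma curve_period: "T (\<delta> + 2 * real CARD('n) * pi) $ j = T \<delta> $ j + 2 * pi"
proof -
  obtain k where k: "\<And>\<delta>. blaschke_angle a (T \<delta> $ j) = \<delta> + k" using blaschke_angle_curve[of j] by metis
  obtain d where d: "T d $ j = T \<delta> $ j + 2 * pi" using curve_surj by blast
  have "d + k = \<delta> + k + 2 * real CARD('n) * pi"
    using k[of d] k[of \<delta>] blaschke_angle_period[of a "T \<delta> $ j"] by (simp add: d)
  then have "d = \<delta> + 2 * real CARD('n) * pi" by simp
  with d show ?thesis by simp
qed

end

lemma ordered_angles_range:
  fixes \<tau> :: "real ^ 'n::{finite,linorder}"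
  assumes "\<tau> \<in> ordered_angles"
  shows "\<tau> $ j \<in> {\<tau> $ Min UNIV..<\<tau> $ Min UNIV + 2 * pi}"
proof -
  have "mono (($) \<tau>)" using assms
    by (auto simp: ordered_angles_def mono_def le_less)
  then have "\<tau> $ Min UNIV \<le> \<tau> $ j" "\<tau> $ j \<le> \<tau> $ Max UNIV" by (auto intro: monoD)
  then show ?thesis using assms by (auto simp: ordered_angles_def)
qed

lemma cis_inj_ordered_angles:
  fixes \<tau> \<sigma> :: "real ^ 'n::{finite,linorder}"
  assumes "\<tau> \<in> ordered_angles" "\<sigma> \<in> ordered_angles" "\<tau> $ Min UNIV = \<sigma> $ Min UNIV" "cis (\<tau> $ i) = cis (\<sigma> $ j)"
  shows "\<tau> $ i = \<sigma> $ j"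
  using ordered_angles_range[OF assms(1), of i] ordered_angles_range[OF assms(2), of j] assms(3,4)
  by (intro cis_eq_imp_eq) auto

lemma inj_circle_points_ordered:
  fixes \<tau> :: "real ^ 'n::{finite,linorder}"
  assumes "\<tau> \<in> ordered_angles"
  shows "inj (($) (circle_points \<tau>))"
  unfolding inj_circle_points_iff
proof (intro allI impI notI)
  fix i j assume "i \<noteq> j" "cis (\<tau> $ i) = cis (\<tau> $ j)"
  then have "\<tau> $ i = \<tau> $ j" using cis_inj_ordered_angles[OF assms assms] by blast
  with \<open>i \<noteq> j\<close> assms show False by (metis (mono_tags, lifting) less_irrefl linorder_neqE mem_Collect_eq ordered_angles_def)
qed

text \<open>
  If \<open>f i = g k\<close>, then \<open>i\<close> and \<open>k\<close> have equally many predecessors, because \<open>f\<close> and \<open>g\<close> have the same values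
  below this number.
\<close>

lemma strict_mono_eqI_range:
  fixes f g :: "'i::{finite,linorder} \<Rightarrow> real"
  assumes f: "strict_mono f" and g: "strict_mono g" and range: "range f \<subseteq> range g"
  shows "f = g"
proof
  fix i
  have "card (range f) = card (range g)"
    using f g by (simp add: card_image strict_mono_imp_inj_on)
  then have eq: "range f = range g" using range by (intro card_subset_eq) auto
  have below: "{y \<in> range h. y < h k} = h ` {..<k}" if "strict_mono h" for h :: "'i \<Rightarrow> real" and k
    using that by (auto simp: strict_mono_less)
  obtain k where k: "f i = g k" using range by auto
  have "f ` {..<i} = g ` {..<k}" using below[OF f, of i] below[OF g, of k] k eq by simp
  then have "card {..<i} = card {..<k}"
    by (metis card_image f g inj_on_subset strict_mono_imp_inj_on subset_UNIV)
  moreover have "card {..<l} < card {..<m}" if "l < m" for l m :: 'i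
    using that by (intro psubset_card_mono) auto
  ultimately have "i = k" by (metis less_irrefl linorder_neqE)
  with k show "f i = g i" by simp
qed

lemma ordered_angles_eqI:
  fixes \<tau> \<sigma> :: "real ^ 'n::{finite,linorder}"
  assumes \<tau>: "\<tau> \<in> ordered_angles" and \<sigma>: "\<sigma> \<in> ordered_angles"
    and start: "\<tau> $ Min UNIV = \<sigma> $ Min UNIV"
    and range: "range (($) (circle_points \<tau>)) \<subseteq> range (($) (circle_points \<sigma>))"
  shows "\<tau> = \<sigma>"
proof -
  have "range (($) \<tau>) \<subseteq> range (($) \<sigma>)"
  proof (intro image_subsetI)
    fix i
    obtain j where "cis (\<tau> $ i) = cis (\<sigma> $ j)"
      using subsetD[OF range rangeI[of _ i]] by auto
    then have "\<tau> $ i = \<sigma> $ j" by (rule cis_inj_ordered_angles[OF \<tau> \<sigma> start])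
    then show "\<tau> $ i \<in> range (($) \<sigma>)" by simp
  qed
  then have "($) \<tau> = ($) \<sigma>"
    by (intro strict_mono_eqI_range) (use \<tau> \<sigma> in \<open>auto simp: ordered_angles_def strict_mono_def\<close>)
  then show ?thesis by (simp add: vec_eq_iff)
qed

theorem theorem1:
  fixes a :: "complex ^ 'n::{finite,linorder}"
    and \<zeta> :: "nat \<Rightarrow> complex"
    and \<alpha> :: real
    and T :: "real \<Rightarrow> real ^ 'n::{finite,linorder}"
  assumes "\<And>j. a $ j \<in> ball 0 1"
    and "deriv (blaschke a) 0 \<noteq> 0"
    and "lists_critical_points a \<zeta>"
    and "is_Arg (blaschke a 1) \<alpha>" and "\<alpha> \<in> {-pi..<pi}"
    and "solution_curve a \<alpha> T"
  shows "{\<tau> \<in> ordered_angles \<inter> half_open_cube (T \<alpha>). gradient_vanishes \<zeta> \<tau>} =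
             T ` {\<alpha>..<\<alpha> + 2 * real CARD('n) * pi} \<and>
         (\<forall>p \<in> range T. \<forall>\<sigma> :: real ^ 'n::{finite,linorder}. angular_energy \<zeta> p \<le> angular_energy \<zeta> \<sigma>)"
proof -
  let ?R = "blaschke_wronskian a"
  let ?\<beta> = "\<alpha> + 2 * real CARD('n) * pi"
  note a = assms(1) and curve = assms(6)
  have R: "circle_positive CARD('n) ?R" by (rule circle_positive_blaschke_wronskian[OF a])
  obtain c where c: "c > 0" and fact: "\<forall>x. cmod x = 1 \<longrightarrow> cmod (poly ?R x) =
       c * (\<Prod>k\<in>{1..<CARD('n)}. cmod ((x - \<zeta> k) * (x - reflect (\<zeta> k))))"
    using critical_point_factorization[OF a assms(3)] by metis
  have ordered: "T \<delta> \<in> ordered_angles" for \<delta> using curve by (simp add: solution_curve_def)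
  note inj_T = inj_circle_points_ordered[OF ordered]
  have mono: "strict_mono (\<lambda>\<delta>. T \<delta> $ j)" for j using curve by (simp add: solution_curve_def)
  have fibre: "blaschke a (circle_points (T \<delta>) $ k) = cis \<delta>" for \<delta> k
    using curve by (simp add: solution_curve_def)
  have free_T: "residue_free ?R (circle_points (T \<delta>))" for \<delta>
    by (rule residue_free_fibre[OF a inj_T _ fibre]) auto
  have free_min: "log_ratio ?R (circle_points \<tau>) \<le> log_ratio ?R (circle_points \<sigma>)"
    if "inj (($) (circle_points \<tau>))" "inj (($) (circle_points \<sigma>))" "residue_free ?R (circle_points \<tau>)"
    for \<tau> \<sigma> :: "real ^ 'n::{finite,linorder}"
    using residue_free_minimal[OF that(1) _ that(2) _ R that(3)] log_ratio_le_iff[OF that(1) _ that(2) _ R]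
    by simp
  have min_T: "angular_energy \<zeta> (T \<delta>) \<le> angular_energy \<zeta> \<sigma>"
    for \<delta> and \<sigma> :: "real ^ 'n::{finite,linorder}"
  proof (cases "inj (($) (circle_points \<sigma>))")
    case True
    then show ?thesis
      using free_min[OF inj_T True free_T]
      by (simp add: angular_energy_eq_log_ratio[OF R c fact] inj_T)
  next
    case False
    then have "angular_energy \<zeta> \<sigma> = \<infinity>"
      by (auto simp: angular_energy_def energy_def inj_circle_points_iff)
    then show ?thesis by simp
  qed
  have "T \<delta> \<in> half_open_cube (T \<alpha>)" if "\<delta> \<in> {\<alpha>..<?\<beta>}" for \<delta>
  proof -
    have "T \<delta> $ j \<in> {T \<alpha> $ j..<T \<alpha> $ j + 2 * pi}" for j
      using that strict_mono_less_eq[OF mono[of j], of \<alpha> \<delta>] strict_mono_less[OF mono[of j], of \<delta> ?\<beta>]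
        curve_period[OF a curve, of \<alpha> j] by simp
    then show ?thesis by (simp add: half_open_cube_def)
  qed
  moreover have "gradient_vanishes \<zeta> (T \<delta>)" for \<delta>
    by (rule minimum_gradient_vanishes[OF R c fact inj_T]) (rule free_min[OF inj_T _ free_T])
  moreover have "\<tau> \<in> T ` {\<alpha>..<?\<beta>}"
    if \<tau>: "\<tau> \<in> ordered_angles" "\<tau> \<in> half_open_cube (T \<alpha>)" and grad: "gradient_vanishes \<zeta> \<tau>" for \<tau>
  proof -
    let ?m = "Min (UNIV :: 'n set)"
    note inj = inj_circle_points_ordered[OF \<tau>(1)]
    have free: "residue_free ?R (circle_points \<tau>)"
      by (rule gradient_vanishes_residue_free[OF R c fact inj grad])
    \<comment> \<open>The fibre through the first point of \<open>\<tau>\<close>.\<close>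
    obtain \<delta> where \<delta>: "T \<delta> $ ?m = \<tau> $ ?m" using curve_surj[OF a curve] by blast
    have "T \<alpha> $ ?m \<le> T \<delta> $ ?m" "T \<delta> $ ?m < T ?\<beta> $ ?m"
      using \<tau>(2) curve_period[OF a curve, of \<alpha> ?m] unfolding \<delta> by (auto simp: half_open_cube_def)
    then have "\<delta> \<in> {\<alpha>..<?\<beta>}"
      using strict_mono_less_eq[OF mono[of ?m], of \<alpha> \<delta>] strict_mono_less[OF mono[of ?m], of \<delta> ?\<beta>] by simp
    moreover have "\<tau> = T \<delta>"
    proof (rule ordered_angles_eqI[OF \<tau>(1) ordered])
      show "range (($) (circle_points \<tau>)) \<subseteq> range (($) (circle_points (T \<delta>)))"
      proof (rule residue_free_minimal_unique[OF inj_T _ inj _ R free_T])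
        show "(\<Prod>i\<in>UNIV. cmod (poly ?R (circle_points (T \<delta>) $ i))) * separation (circle_points \<tau>) =
            (\<Prod>i\<in>UNIV. cmod (poly ?R (circle_points \<tau> $ i))) * separation (circle_points (T \<delta>))"
          using residue_free_minimal[OF inj_T _ inj _ R free_T] residue_free_minimal[OF inj _ inj_T _ R free]
          by (intro antisym) auto
        show "circle_points \<tau> $ ?m = circle_points (T \<delta>) $ ?m" by (simp add: \<delta>)
      qed auto
    qed (simp add: \<delta>)
    ultimately show ?thesis by blast
  qed
  ultimately show ?thesis using ordered min_T by blast
qed

end
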